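(* Let $X$ be a compact plane set and let $E$ be a countable subset of $X$. Let $(X_\alpha)$ be a family of compact plane sets such that $R(X_\alpha)$ is regular for all $\alpha$ and $\bigcup_\alpha \operatorname{int}_X(X\cap X_\alpha)\supseteq X\setminus E$. Then $R(X)$ is regular.
   Context: A compact plane set is a non-empty compact subset of $\mathbb C$. For a compact plane set $X$, $R(X)$ is the set of continuous functions $f:X\to\mathbb C$ that can be uniformly approximated on $X$ by rational functions with no poles on $X$. $R(X)$ is regular if for every closed set $E\subseteq X$ and every $x\in X\setminus E$ there exists $f\in R(X)$ with $f(x)=1$ and $f(y)=0$ for all $y\in E$. For $E\subseteq X$, $\operatorname{int}_X E$ denotes the interior of $E$ in the topological space $X$. The sets $X_\alpha$ are not assumed to be contained in $X$. *)

theory Defs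
  imports "HOL-Analysis.Analysis" "HOL-Computational_Algebra.Polynomial"
begin

definition compact_plane_set :: "complex set \<Rightarrow> bool" where
  "compact_plane_set X \<longleftrightarrow> compact X \<and> X \<noteq> {}"

text \<open>
  Functions on \<open>X\<close> are represented by total functions, whose values outside \<open>X\<close> are irrelevant.
  A rational function without poles on \<open>X\<close> is a quotient of two polynomials whose denominator
  has no zero on \<open>X\<close> (after cancelling common factors, every such function has this form).
\<close>

definition rational_without_poles_on :: "complex set \<Rightarrow> (complex \<Rightarrow> complex) set" where
  "rational_without_poles_on X =
     {\<lambda>z. poly p z / poly q z | p q. \<forall>z\<in>X. poly q z \<noteq> 0}"

definition R :: "complex set \<Rightarrow> (complex \<Rightarrow> complex) set" where
  "R X = {f. continuous_on X f \<and>
             (\<forall>\<epsilon>>0. \<exists>r\<in>rational_without_poles_on X. \<forall>z\<in>X. norm (f z - r z) < \<epsilon>)}"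

definition regular_on :: "complex set \<Rightarrow> (complex \<Rightarrow> complex) set \<Rightarrow> bool" where
  "regular_on X A \<longleftrightarrow>
     (\<forall>E x. closed E \<and> E \<subseteq> X \<and> x \<in> X - E \<longrightarrow> (\<exists>f\<in>A. f x = 1 \<and> (\<forall>y\<in>E. f y = 0)))"

end

theory Submission
  imports Defs
begin

text \<open>
  Fix \<open>x\<^sub>0 \<in> X\<close> and a closed set \<open>A\<close> avoiding \<open>x\<^sub>0\<close>. As \<open>E\<close> is countable, some circle around \<open>x\<^sub>0\<close>
  of radius less than the distance to \<open>A\<close> misses \<open>E\<close>, so each point \<open>c\<close> of \<open>X\<close> on it has a
  neighbourhood in \<open>X\<close> that lies in some \<open>Y \<alpha>\<close>. Since \<open>R (Y \<alpha>)\<close> is normal, it contains a function that is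
  \<open>1\<close> near \<open>c\<close> and \<open>0\<close> off a small disc; extended by \<open>0\<close> it belongs to \<open>R X\<close>. Subtracting from \<open>1\<close> and
  multiplying finitely many of these gives \<open>H \<in> R X\<close> that vanishes near the circle with \<open>H x\<^sub>0 = 1\<close>,
  and replacing \<open>H\<close> by \<open>0\<close> outside the circle stays in \<open>R X\<close>.

  Both extensions by \<open>0\<close> are instances of a localization lemma. It comes from a discrete Vitushkin
  operator: a cutoff function is an average of \<open>1 / (1 - (z / \<rho>)\<^sup>n)\<close> over radii \<open>\<rho>\<close>, that is, a sum of
  simple fractions \<open>a / (a - z)\<close> over a polar grid, and a pole \<open>a\<close> near \<open>X\<close> is removed by replacing
  \<open>r z / (a - z)\<close> by \<open>(r z - r a) / (a - z)\<close>. The error is a discrete area integral of \<open>1 / \<bar>a - z\<bar>\<close>.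

  Normality holds because an ideal of \<open>R Y\<close> without common zeros is everything, a form of the
  Gelfand--Mazur theorem that is proved with the same roots of unity averages, following Rickart.
\<close>

section \<open>The algebra \<open>R X\<close>\<close>

lemma rational_poly: "(\<lambda>z. poly p z) \<in> rational_without_poles_on X"
  unfolding rational_without_poles_on_def
  by (intro CollectI exI[of _ p] exI[of _ 1]) auto

lemma rational_const: "(\<lambda>z. c) \<in> rational_without_poles_on X"
  using rational_poly[of "[:c:]"] by simp

lemma rational_inverse_linear:
  assumes "a \<notin> X"
  shows "(\<lambda>z. 1 / (a - z)) \<in> rational_without_poles_on X"
  unfolding rational_without_poles_on_def
  by (intro CollectI exI[of _ 1] exI[of _ "[:a, -1:]"]) (use assms in auto)

text \<open>Equality is claimed on \<open>X\<close> only: division by zero yields 0 in HOL, so at a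
  zero of one denominator the pointwise sum can differ from the quotient over the common
  denominator. Products do not have this defect.\<close>

lemma rational_add:
  assumes "f \<in> rational_without_poles_on X" "g \<in> rational_without_poles_on X"
  shows "\<exists>h\<in>rational_without_poles_on X. \<forall>z\<in>X. h z = f z + g z"
proof -
  obtain p q where f: "f = (\<lambda>z. poly p z / poly q z)" "\<forall>z\<in>X. poly q z \<noteq> 0"
    using assms(1) unfolding rational_without_poles_on_def by blast
  obtain p' q' where g: "g = (\<lambda>z. poly p' z / poly q' z)" "\<forall>z\<in>X. poly q' z \<noteq> 0"
    using assms(2) unfolding rational_without_poles_on_def by blast
  have "(\<lambda>z. poly (p * q' + p' * q) z / poly (q * q') z) \<in> rational_without_poles_on X"
    unfolding rational_without_poles_on_def mem_Collect_eq using f g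
    by (intro exI[of _ "p * q' + p' * q"] exI[of _ "q * q'"]) auto
  moreover have "\<forall>z\<in>X. poly (p * q' + p' * q) z / poly (q * q') z = f z + g z"
    using f g by (auto simp: field_simps)
  ultimately show ?thesis by (intro bexI[of _ "\<lambda>z. poly (p * q' + p' * q) z / poly (q * q') z"])
qed

lemma rational_mult:
  assumes "f \<in> rational_without_poles_on X" "g \<in> rational_without_poles_on X"
  shows "(\<lambda>z. f z * g z) \<in> rational_without_poles_on X"
proof -
  obtain p q where f: "f = (\<lambda>z. poly p z / poly q z)" "\<forall>z\<in>X. poly q z \<noteq> 0"
    using assms(1) unfolding rational_without_poles_on_def by blast
  obtain p' q' where g: "g = (\<lambda>z. poly p' z / poly q' z)" "\<forall>z\<in>X. poly q' z \<noteq> 0"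
    using assms(2) unfolding rational_without_poles_on_def by blast
  show ?thesis
    unfolding rational_without_poles_on_def using f g
    by (intro CollectI exI[of _ "p * p'"] exI[of _ "q * q'"]) auto
qed

lemma rational_continuous_on:
  "f \<in> rational_without_poles_on X \<Longrightarrow> continuous_on X f"
  unfolding rational_without_poles_on_def by (auto intro!: continuous_intros)

lemma R_continuous_on: "f \<in> R X \<Longrightarrow> continuous_on X f"
  by (simp add: R_def)

lemma R_approx:
  assumes "f \<in> R X" "e > 0"
  obtains r where "r \<in> rational_without_poles_on X" "\<And>z. z \<in> X \<Longrightarrow> norm (f z - r z) < e"
  using assms unfolding R_def by blast

text \<open>Continuity is inherited from the rational approximants, since uniform limits preserve
  it. Membership in \<open>R X\<close> is thereby reduced to approximation.\<close>

lemma R_I: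
  assumes "\<And>e. e > 0 \<Longrightarrow> \<exists>r\<in>rational_without_poles_on X. \<forall>z\<in>X. norm (f z - r z) < e"
  shows "f \<in> R X"
proof -
  have "\<forall>n. \<exists>r\<in>rational_without_poles_on X. \<forall>z\<in>X. norm (f z - r z) < inverse (Suc n)"
    using assms by simp
  then obtain r where r: "\<And>n. r n \<in> rational_without_poles_on X"
    "\<And>n z. z \<in> X \<Longrightarrow> norm (f z - r n z) < inverse (Suc n)" by metis
  have "uniform_limit X r f sequentially"
  proof (rule uniform_limitI)
    fix e :: real assume "e > 0"
    then obtain N where N: "inverse (Suc N) < e" using reals_Archimedean by blast
    show "\<forall>\<^sub>F n in sequentially. \<forall>x\<in>X. dist (r n x) (f x) < e"
    proof (rule eventually_sequentiallyI[of N], intro ballI)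
      fix n x assume "N \<le> n" "x \<in> X"
      have "dist (r n x) (f x) < inverse (Suc n)"
        using r(2)[OF \<open>x \<in> X\<close>] by (simp add: dist_norm norm_minus_commute)
      also have "\<dots> \<le> inverse (Suc N)" using \<open>N \<le> n\<close> by (simp add: le_imp_inverse_le)
      finally show "dist (r n x) (f x) < e" using N by simp
    qed
  qed
  then have "continuous_on X f"
    by (rule uniform_limit_theorem[rotated])
      (auto intro: always_eventually rational_continuous_on[OF r(1)])
  with assms show ?thesis unfolding R_def by auto
qed

lemma R_limit:
  assumes "\<And>e. e > 0 \<Longrightarrow> \<exists>g\<in>R X. \<forall>z\<in>X. norm (f z - g z) \<le> e"
  shows "f \<in> R X"
proof (rule R_I)
  fix e :: real assume e: "e > 0"
  then obtain g where g: "g \<in> R X" "\<And>z. z \<in> X \<Longrightarrow> norm (f z - g z) \<le> e / 2"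
    using assms[of "e / 2"] by auto
  obtain r where r: "r \<in> rational_without_poles_on X" "\<And>z. z \<in> X \<Longrightarrow> norm (g z - r z) < e / 2"
    using R_approx[OF g(1), of "e / 2"] e by auto
  have "norm (f z - r z) < e" if "z \<in> X" for z
    using g(2)[OF that] r(2)[OF that] norm_triangle_ineq[of "f z - g z" "g z - r z"] by simp
  with r show "\<exists>r\<in>rational_without_poles_on X. \<forall>z\<in>X. norm (f z - r z) < e" by blast
qed

lemma rational_in_R: "r \<in> rational_without_poles_on X \<Longrightarrow> r \<in> R X"
  by (rule R_I) force

lemma R_const: "(\<lambda>z. c) \<in> R X"
  by (intro rational_in_R rational_const)

lemma R_ident: "(\<lambda>z. z) \<in> R X"
  using rational_in_R[OF rational_poly[of "[:0, 1:]"]] by simp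

lemma R_cong:
  assumes "f \<in> R X" "\<And>z. z \<in> X \<Longrightarrow> f z = g z"
  shows "g \<in> R X"
proof (rule R_I)
  fix e :: real assume "e > 0"
  then obtain r where "r \<in> rational_without_poles_on X" "\<And>z. z \<in> X \<Longrightarrow> norm (f z - r z) < e"
    using R_approx[OF assms(1)] by blast
  with assms(2) show "\<exists>r\<in>rational_without_poles_on X. \<forall>z\<in>X. norm (g z - r z) < e" by auto
qed

lemma R_add:
  assumes "f \<in> R X" "g \<in> R X"
  shows "(\<lambda>z. f z + g z) \<in> R X"
proof (rule R_I)
  fix e :: real assume "e > 0"
  then have e: "e / 2 > 0" by simp
  obtain r where r: "r \<in> rational_without_poles_on X" "\<And>z. z \<in> X \<Longrightarrow> norm (f z - r z) < e / 2"
    using R_approx[OF assms(1) e] by blast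
  obtain s where s: "s \<in> rational_without_poles_on X" "\<And>z. z \<in> X \<Longrightarrow> norm (g z - s z) < e / 2"
    using R_approx[OF assms(2) e] by blast
  obtain h where h: "h \<in> rational_without_poles_on X" "\<forall>z\<in>X. h z = r z + s z"
    using rational_add[OF r(1) s(1)] by blast
  have "norm (f z + g z - h z) < e" if "z \<in> X" for z
    using norm_triangle_ineq[of "f z - r z" "g z - s z"] r(2)[OF that] s(2)[OF that] h that
    by (simp add: algebra_simps)
  with h show "\<exists>r\<in>rational_without_poles_on X. \<forall>z\<in>X. norm (f z + g z - r z) < e" by blast
qed

lemma R_bounded:
  assumes "compact X" "f \<in> R X"
  obtains M where "M > 0" "\<And>z. z \<in> X \<Longrightarrow> norm (f z) \<le> M"
proof -
  have "bounded (f ` X)"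
    using assms by (intro compact_imp_bounded compact_continuous_image R_continuous_on)
  then show ?thesis using that unfolding bounded_pos by auto
qed

lemma R_mult:
  assumes X: "compact X" and f: "f \<in> R X" and g: "g \<in> R X"
  shows "(\<lambda>z. f z * g z) \<in> R X"
proof (rule R_I)
  fix e :: real assume e: "e > 0"
  obtain M where M: "M > 0" "\<And>z. z \<in> X \<Longrightarrow> norm (f z) \<le> M" using R_bounded[OF X f] by blast
  have "e / (2 * M) > 0" using e M by simp
  then obtain s where s: "s \<in> rational_without_poles_on X"
    "\<And>z. z \<in> X \<Longrightarrow> norm (g z - s z) < e / (2 * M)"
    using R_approx[OF g] by blast
  \<comment> \<open>\<open>s\<close> is fixed before \<open>r\<close>, so that its bound
    \<open>N\<close> can set the tolerance for \<open>r\<close>.\<close>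
  obtain N where N: "N > 0" "\<And>z. z \<in> X \<Longrightarrow> norm (s z) \<le> N"
    using R_bounded[OF X rational_in_R[OF s(1)]] by blast
  have "e / (2 * N) > 0" using e N by simp
  then obtain r where r: "r \<in> rational_without_poles_on X"
    "\<And>z. z \<in> X \<Longrightarrow> norm (f z - r z) < e / (2 * N)"
    using R_approx[OF f] by blast
  have "norm (f z * g z - r z * s z) < e" if z: "z \<in> X" for z
  proof -
    have "f z * g z - r z * s z = f z * (g z - s z) + (f z - r z) * s z"
      by (simp add: algebra_simps)
    also have "norm \<dots> \<le> norm (f z) * norm (g z - s z) + norm (f z - r z) * norm (s z)"
      using norm_triangle_ineq norm_mult by metis
    also have "\<dots> \<le> M * norm (g z - s z) + norm (f z - r z) * N"
      using M(2)[OF z] N(2)[OF z] M(1) N(1) by (intro add_mono mult_mono) auto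
    also have "\<dots> < M * (e / (2 * M)) + e / (2 * N) * N"
      using s(2)[OF z] r(2)[OF z] M N by (intro add_strict_mono mult_strict_left_mono mult_strict_right_mono) auto
    also have "\<dots> = e" using M N by simp
    finally show ?thesis .
  qed
  then show "\<exists>h\<in>rational_without_poles_on X. \<forall>z\<in>X. norm (f z * g z - h z) < e"
    using rational_mult[OF r(1) s(1)] by (intro bexI[of _ "\<lambda>z. r z * s z"]) auto
qed

lemma R_diff:
  assumes "compact X" "f \<in> R X" "g \<in> R X"
  shows "(\<lambda>z. f z - g z) \<in> R X"
  using R_add[OF assms(2) R_mult[OF assms(1) R_const[of "-1"] assms(3)]] by simp

lemma R_sum:
  assumes "finite S" "\<And>i. i \<in> S \<Longrightarrow> f i \<in> R X"
  shows "(\<lambda>z. \<Sum>i\<in>S. f i z) \<in> R X"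
  using assms by (induction S rule: finite_induct) (auto intro: R_const R_add)

lemma R_prod:
  assumes "compact X" "finite S" "\<And>i. i \<in> S \<Longrightarrow> f i \<in> R X"
  shows "(\<lambda>z. \<Prod>i\<in>S. f i z) \<in> R X"
  using assms(2,3) by (induction S rule: finite_induct) (auto intro: R_const R_mult[OF assms(1)])

lemma R_power:
  assumes "compact X" "f \<in> R X"
  shows "(\<lambda>z. f z ^ n) \<in> R X"
  by (induction n) (auto intro: R_const R_mult assms)

lemma R_inverse:
  assumes X: "compact X" and f: "f \<in> R X" and nz: "\<And>z. z \<in> X \<Longrightarrow> f z \<noteq> 0"
  shows "(\<lambda>z. 1 / f z) \<in> R X"
proof (cases "X = {}")
  case True
  then show ?thesis by (intro R_I) (auto intro: rational_const)
next
  case False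
  have "continuous_on X (\<lambda>z. norm (f z))" by (intro continuous_intros R_continuous_on f)
  then obtain x where "x \<in> X" "\<And>z. z \<in> X \<Longrightarrow> norm (f x) \<le> norm (f z)"
    using continuous_attains_inf[OF X False] by blast
  then obtain m where m: "m > 0" "\<And>z. z \<in> X \<Longrightarrow> m \<le> norm (f z)"
    using nz[of x] that[of "norm (f x)"] by simp
  show ?thesis
  proof (rule R_I)
    fix e :: real assume e: "e > 0"
    \<comment> \<open>The bound \<open>m / 2\<close> keeps \<open>norm (r z)\<close> above
      \<open>m / 2\<close>, so \<open>poly p\<close> has no zero on \<open>X\<close>. The other
      bound is \<open>e\<close> times the resulting lower bound \<open>m * (m / 2)\<close> of
      \<open>norm (f z) * norm (r z)\<close>.\<close>
    define d where "d = min (m / 2) (e * m * m / 2)"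
    have "d > 0" using m e by (simp add: d_def)
    then obtain r where r: "r \<in> rational_without_poles_on X" "\<And>z. z \<in> X \<Longrightarrow> norm (f z - r z) < d"
      using R_approx[OF f] by blast
    obtain p q where pq: "r = (\<lambda>z. poly p z / poly q z)" "\<forall>z\<in>X. poly q z \<noteq> 0"
      using r(1) unfolding rational_without_poles_on_def by blast
    have rm: "m / 2 < norm (r z)" if z: "z \<in> X" for z
      using r(2)[OF z] m(2)[OF z] norm_triangle_ineq2[of "f z" "r z"] by (simp add: d_def)
    have "poly p z \<noteq> 0" if "z \<in> X" for z
      using rm[OF that] m(1) pq by auto
    then have "(\<lambda>z. poly q z / poly p z) \<in> rational_without_poles_on X"
      unfolding rational_without_poles_on_def by blast
    moreover have "norm (1 / f z - poly q z / poly p z) < e" if z: "z \<in> X" for z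
    proof -
      have "r z \<noteq> 0" using rm[OF z] m(1) by auto
      then have "1 / f z - poly q z / poly p z = (r z - f z) / (f z * r z)"
        using pq nz[OF z] by (auto simp: field_simps)
      then have "norm (1 / f z - poly q z / poly p z) = norm (f z - r z) / (norm (f z) * norm (r z))"
        by (simp add: norm_divide norm_mult norm_minus_commute)
      also have "\<dots> < e"
      proof -
        have "m * (m / 2) \<le> norm (f z) * norm (r z)"
          using m(1) m(2)[OF z] rm[OF z] by (intro mult_mono) auto
        then have "e * (m * (m / 2)) \<le> e * (norm (f z) * norm (r z))" using e by simp
        moreover have "norm (f z - r z) < e * (m * (m / 2))"
          using r(2)[OF z] by (simp add: d_def algebra_simps)
        ultimately show ?thesis
          using nz[OF z] \<open>r z \<noteq> 0\<close> by (simp add: pos_divide_less_eq)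
      qed
      finally show ?thesis .
    qed
    ultimately show "\<exists>r\<in>rational_without_poles_on X. \<forall>z\<in>X. norm (1 / f z - r z) < e"
      by (intro bexI[of _ "\<lambda>z. poly q z / poly p z"]) auto
  qed
qed

lemma R_divide_const: "compact X \<Longrightarrow> f \<in> R X \<Longrightarrow> (\<lambda>z. f z / c) \<in> R X"
  using R_mult[OF _ _ R_const[of "inverse c"]] by (simp add: divide_inverse)

section \<open>Difference quotients with bounds uniform in the base point\<close>

lemma poly_bounded_on_cball:
  fixes p :: "complex poly"
  obtains M where "M > 0" "\<And>z. norm z \<le> B \<Longrightarrow> norm (poly p z) \<le> M"
proof -
  have "bounded (poly p ` cball 0 B)"
    by (intro compact_imp_bounded compact_continuous_image continuous_intros compact_cball)
  then show ?thesis using that unfolding bounded_pos by auto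
qed

text \<open>Division by \<open>z - a\<close> along Horner's scheme. The induction carries a single
  bound \<open>L\<close> for all \<open>a\<close> in the disc, which is what a simultaneous removal
  of many poles requires.\<close>

lemma poly_diff_quotient:
  fixes p :: "complex poly"
  shows "\<exists>L. \<forall>a. \<exists>P. (\<forall>z. poly p z - poly p a = (z - a) * poly P z) \<and>
    (norm a \<le> B \<longrightarrow> (\<forall>z. norm z \<le> B \<longrightarrow> norm (poly P z) \<le> L))"
proof (induction p)
  case 0
  show ?case by (intro exI[of _ 0] allI) auto
next
  case (pCons c p)
  then obtain L where L: "\<And>a. \<exists>P. (\<forall>z. poly p z - poly p a = (z - a) * poly P z) \<and>
    (norm a \<le> B \<longrightarrow> (\<forall>z. norm z \<le> B \<longrightarrow> norm (poly P z) \<le> L))" by blast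
  obtain M where M: "\<And>z. norm z \<le> B \<Longrightarrow> norm (poly p z) \<le> M"
    using poly_bounded_on_cball by metis
  show ?case
  proof (intro exI[of _ "M + B * L"] allI)
    fix a
    obtain P where P: "\<And>z. poly p z - poly p a = (z - a) * poly P z"
      "norm a \<le> B \<Longrightarrow> \<forall>z. norm z \<le> B \<longrightarrow> norm (poly P z) \<le> L" using L[of a] by blast
    define P' where "P' = pCons (poly p a) P"
    have "poly (pCons c p) z - poly (pCons c p) a = (z - a) * poly P' z" for z
    proof -
      have "poly (pCons c p) z - poly (pCons c p) a = z * (poly p z - poly p a) + (z - a) * poly p a"
        by (simp add: algebra_simps)
      then show ?thesis unfolding P(1) by (simp add: P'_def algebra_simps)
    qed
    moreover have "norm (poly P' z) \<le> M + B * L" if "norm a \<le> B" "norm z \<le> B" for z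
    proof -
      have "norm (z * poly P z) \<le> B * L"
        unfolding norm_mult using that P(2) order.trans[OF norm_ge_zero that(1)]
        by (intro mult_mono) auto
      then show ?thesis
        unfolding P'_def using norm_triangle_ineq[of "poly p a" "z * poly P z"] M[OF that(1)] by simp
    qed
    ultimately show "\<exists>P. (\<forall>z. poly (pCons c p) z - poly (pCons c p) a = (z - a) * poly P z) \<and>
      (norm a \<le> B \<longrightarrow> (\<forall>z. norm z \<le> B \<longrightarrow> norm (poly P z) \<le> M + B * L))" by blast
  qed
qed

text \<open>The zero of the difference at \<open>z = a\<close> cancels the factor
  \<open>z - a\<close>, and the remaining denominator is \<open>poly q a * poly q z\<close>. Hence
  \<open>a\<close> may lie on \<open>X\<close> itself, and \<open>a\<close> affects the bound only
  through \<open>B\<close> and \<open>\<kappa>\<close>.\<close>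

lemma rational_diff_quotient:
  assumes X: "compact X" and q: "\<And>z. z \<in> X \<Longrightarrow> poly q z \<noteq> 0" and \<kappa>: "\<kappa> > 0"
  shows "\<exists>L>0. \<forall>a. norm a \<le> B \<and> \<kappa> \<le> norm (poly q a) \<longrightarrow> (\<exists>s\<in>rational_without_poles_on X.
    \<forall>z\<in>X. (z - a) * s z = poly p z / poly q z - poly p a / poly q a \<and> norm (s z) \<le> L)"
proof -
  obtain B1 where B1: "\<And>z. z \<in> X \<Longrightarrow> norm z \<le> B1"
    using compact_imp_bounded[OF X] unfolding bounded_iff by blast
  define B' where "B' = max B B1"
  obtain Lp where Lp: "\<And>a. \<exists>P. (\<forall>z. poly p z - poly p a = (z - a) * poly P z) \<and>
    (norm a \<le> B' \<longrightarrow> (\<forall>z. norm z \<le> B' \<longrightarrow> norm (poly P z) \<le> Lp))"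
    using poly_diff_quotient[of p B'] by blast
  obtain Lq where Lq: "\<And>a. \<exists>P. (\<forall>z. poly q z - poly q a = (z - a) * poly P z) \<and>
    (norm a \<le> B' \<longrightarrow> (\<forall>z. norm z \<le> B' \<longrightarrow> norm (poly P z) \<le> Lq))"
    using poly_diff_quotient[of q B'] by blast
  obtain Mp where Mp: "Mp > 0" "\<And>z. norm z \<le> B' \<Longrightarrow> norm (poly p z) \<le> Mp"
    using poly_bounded_on_cball[of B' p] by blast
  obtain Mq where Mq: "Mq > 0" "\<And>z. norm z \<le> B' \<Longrightarrow> norm (poly q z) \<le> Mq"
    using poly_bounded_on_cball[of B' q] by blast
  have "(\<lambda>z. poly 1 z / poly q z) \<in> rational_without_poles_on X"
    unfolding rational_without_poles_on_def using q by blast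
  then obtain N where N: "N > 0" "\<And>z. z \<in> X \<Longrightarrow> norm (poly 1 z / poly q z) \<le> N"
    by (rule R_bounded[OF X rational_in_R]) (rule that)
  define L where "L = (\<bar>Lp\<bar> * Mq + Mp * \<bar>Lq\<bar>) / \<kappa> * N + 1"
  have "L > 0" using Mp Mq N \<kappa> by (auto simp: L_def intro!: add_nonneg_pos)
  moreover have "\<exists>s\<in>rational_without_poles_on X.
      \<forall>z\<in>X. (z - a) * s z = poly p z / poly q z - poly p a / poly q a \<and> norm (s z) \<le> L"
    if a: "norm a \<le> B" "\<kappa> \<le> norm (poly q a)" for a
  proof -
    have a': "norm a \<le> B'" using a by (simp add: B'_def)
    have qa: "poly q a \<noteq> 0" using a \<kappa> by auto
    obtain P where P: "\<And>z. poly p z - poly p a = (z - a) * poly P z"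
      "\<And>z. norm z \<le> B' \<Longrightarrow> norm (poly P z) \<le> Lp" using Lp[of a] a' by blast
    obtain Q where Q: "\<And>z. poly q z - poly q a = (z - a) * poly Q z"
      "\<And>z. norm z \<le> B' \<Longrightarrow> norm (poly Q z) \<le> Lq" using Lq[of a] a' by blast
    define S where "S = smult (poly q a) P - smult (poly p a) Q"
    define s where "s = (\<lambda>z. poly S z / poly (smult (poly q a) q) z)"
    have "s \<in> rational_without_poles_on X"
      unfolding rational_without_poles_on_def s_def mem_Collect_eq using q qa
      by (intro exI[of _ S] exI[of _ "smult (poly q a) q"]) auto
    moreover have "(z - a) * s z = poly p z / poly q z - poly p a / poly q a \<and> norm (s z) \<le> L"
      if z: "z \<in> X" for z
    proof
      have pz: "poly p z = poly p a + (z - a) * poly P z" using P(1)[of z] by (simp add: algebra_simps)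
      have qz: "poly q z = poly q a + (z - a) * poly Q z" using Q(1)[of z] by (simp add: algebra_simps)
      have "poly p z * poly q a - poly p a * poly q z = (z - a) * poly S z"
        unfolding S_def pz qz by (simp add: algebra_simps)
      moreover have "poly p z / poly q z - poly p a / poly q a
          = (poly p z * poly q a - poly p a * poly q z) / (poly q a * poly q z)"
        using qa q[OF z] by (simp add: field_simps)
      ultimately show "(z - a) * s z = poly p z / poly q z - poly p a / poly q a"
        by (simp add: s_def)
      have z': "norm z \<le> B'" using B1[OF z] by (simp add: B'_def)
      have "norm (poly S z) \<le> norm (poly q a * poly P z) + norm (poly p a * poly Q z)"
        unfolding S_def by (simp add: norm_triangle_ineq4)
      also have "\<dots> \<le> Mq * \<bar>Lp\<bar> + Mp * \<bar>Lq\<bar>"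
        unfolding norm_mult using Mp Mq a' z' P(2)[OF z'] Q(2)[OF z']
        by (intro add_mono mult_mono) auto
      finally have S: "norm (poly S z) \<le> \<bar>Lp\<bar> * Mq + Mp * \<bar>Lq\<bar>" by (simp add: mult.commute)
      have "norm (s z) = norm (poly S z) / norm (poly q a) * norm (poly 1 z / poly q z)"
        by (simp add: s_def norm_mult norm_divide)
      also have "\<dots> \<le> (\<bar>Lp\<bar> * Mq + Mp * \<bar>Lq\<bar>) / \<kappa> * N"
        using S a(2) \<kappa> N(1) N(2)[OF z] Mp(1) Mq(1)
        by (intro mult_mono frac_le divide_nonneg_pos) auto
      finally show "norm (s z) \<le> L" by (simp add: L_def)
    qed
    ultimately show ?thesis by blast
  qed
  ultimately show ?thesis by blast
qed

section \<open>Averages over roots of unity\<close>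

lemma cis_root_of_unity:
  assumes "n > 0"
  shows "cis (2 * pi / real n) ^ n = 1"
  using assms by (simp add: Complex.DeMoivre)

lemma cis_root_of_unity_primitive:
  assumes "0 < l" "l < n"
  shows "cis (2 * pi / real n) ^ l \<noteq> 1"
proof
  assume "cis (2 * pi / real n) ^ l = 1"
  then have "Re (cis (real l * (2 * pi / real n))) = Re 1"
    by (simp only: Complex.DeMoivre)
  then have "cos (real l * (2 * pi / real n)) = 1" by simp
  then obtain x :: int where "real l * (2 * pi / real n) = of_int x * 2 * pi"
    unfolding cos_one_2pi_int by auto
  then have "real l = of_int x * real n" using assms by (simp add: field_simps)
  then have "of_int (int l) = (of_int (x * int n) :: real)" by simp
  then have "int l = x * int n" by (simp only: of_int_eq_iff)
  then have "int n dvd int l" by simp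
  then have "n dvd l" by simp
  then show False using assms by (simp add: nat_dvd_not_less)
qed

text \<open>After exchanging the sums, the inner sum over \<open>k\<close> is a multiple of a
  geometric sum over the powers of an \<open>n\<close>-th root of unity. It vanishes unless
  \<open>l = 0\<close>, because that root is then different from 1.\<close>

lemma sum_roots_of_unity_geometric:
  fixes w :: complex and \<rho> :: real
  assumes n: "n > 0" and \<rho>: "\<rho> > 0"
  shows "(\<Sum>k<n. \<Sum>l<n. (w / (of_real \<rho> * cis (2 * pi / real n) ^ k)) ^ l) = of_nat n"
proof -
  define \<omega> where "\<omega> = cis (2 * pi / real n)"
  have \<omega>0: "\<omega> \<noteq> 0" by (simp add: \<omega>_def)
  have \<omega>n: "\<omega> ^ n = 1" unfolding \<omega>_def by (rule cis_root_of_unity[OF n])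
  have "(\<Sum>k<n. (w / (of_real \<rho> * \<omega> ^ k)) ^ l) = (if l = 0 then of_nat n else 0)" if "l < n" for l
  proof (cases "l = 0")
    case False
    define u where "u = inverse (\<omega> ^ l)"
    have "(w / (of_real \<rho> * \<omega> ^ k)) ^ l = (w / \<rho>) ^ l * u ^ k" for k
      using \<rho> \<omega>0 by (simp add: u_def field_simps power_mult_distrib flip: power_mult)
    then have "(\<Sum>k<n. (w / (of_real \<rho> * \<omega> ^ k)) ^ l) = (w / \<rho>) ^ l * (\<Sum>k<n. u ^ k)"
      by (simp add: sum_distrib_left)
    also have "(\<Sum>k<n. u ^ k) = 0"
    proof -
      have "\<omega> ^ l \<noteq> 1"
        unfolding \<omega>_def using cis_root_of_unity_primitive[of l n] that False by simp
      then have "u \<noteq> 1" by (simp add: u_def)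
      moreover have "u ^ n = (inverse (\<omega> ^ n)) ^ l"
        by (simp add: u_def power_inverse mult.commute flip: power_mult)
      then have "u ^ n = 1" using \<omega>n by simp
      ultimately show ?thesis by (simp add: sum_gp_strict)
    qed
    finally show ?thesis using False by simp
  qed auto
  then have "(\<Sum>l<n. \<Sum>k<n. (w / (of_real \<rho> * \<omega> ^ k)) ^ l) = of_nat n"
    using n by simp
  then show ?thesis unfolding \<omega>_def by (subst sum.swap)
qed

text \<open>The partial fraction decomposition of \<open>1 / (1 - (w / \<rho>) ^ n)\<close>,
  multiplied out. Each summand becomes a finite geometric sum in \<open>w / t k\<close>, since
  \<open>(w / t k) ^ n\<close> does not depend on \<open>k\<close>.\<close>

lemma sum_roots_of_unity_resolvent:
  fixes w :: complex and \<rho> :: real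
  assumes n: "n > 0" and \<rho>: "\<rho> > 0" and w: "norm w \<noteq> \<rho>"
  defines "t \<equiv> \<lambda>k. of_real \<rho> * cis (2 * pi / real n) ^ k"
  shows "(\<Sum>k<n. t k / (t k - w)) * (1 - (w / of_real \<rho>) ^ n) = of_nat n"
proof -
  have t0: "t k \<noteq> 0" for k using \<rho> by (simp add: t_def)
  have tw: "t k \<noteq> w" for k
  proof
    assume "t k = w"
    then have "norm w = \<rho>" using \<rho> by (auto simp: t_def norm_mult norm_power)
    with w show False by simp
  qed
  have tn: "(w / t k) ^ n = (w / of_real \<rho>) ^ n" for k
  proof -
    have "t k ^ n = of_real \<rho> ^ n * (cis (2 * pi / real n) ^ n) ^ k"
      by (simp add: t_def power_mult_distrib mult.commute flip: power_mult)
    then have "t k ^ n = of_real \<rho> ^ n"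
      by (simp only: cis_root_of_unity[OF n] power_one mult_1_right)
    then show ?thesis by (simp add: power_divide)
  qed
  have "t k / (t k - w) * (1 - (w / of_real \<rho>) ^ n) = (\<Sum>l<n. (w / t k) ^ l)" for k
  proof -
    have "1 - (w / of_real \<rho>) ^ n = (1 - w / t k) * (\<Sum>l<n. (w / t k) ^ l)"
      using one_diff_power_eq[of "w / t k" n] tn[of k] by simp
    moreover have "t k / (t k - w) * (1 - w / t k) = 1"
      using t0[of k] tw[of k] by (simp add: field_simps)
    ultimately show ?thesis by (simp add: mult.assoc[symmetric])
  qed
  then show ?thesis
    using sum_roots_of_unity_geometric[OF n \<rho>, of w]
    by (simp add: sum_distrib_right t_def)
qed

section \<open>Ideals without common zeros\<close>

text \<open>An ideal of \<open>R Y\<close>. The rule \<open>J_cong\<close> expresses that elements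
  are total functions of which only the values on \<open>Y\<close> count.\<close>

locale R_ideal =
  fixes Y :: "complex set" and J :: "(complex \<Rightarrow> complex) set"
  assumes Y: "compact Y"
    and J_R: "f \<in> J \<Longrightarrow> f \<in> R Y"
    and J_0: "(\<lambda>z. 0) \<in> J"
    and J_add: "f \<in> J \<Longrightarrow> g \<in> J \<Longrightarrow> (\<lambda>z. f z + g z) \<in> J"
    and J_mult: "f \<in> R Y \<Longrightarrow> g \<in> J \<Longrightarrow> (\<lambda>z. f z * g z) \<in> J"
    and J_cong: "f \<in> J \<Longrightarrow> (\<And>z. z \<in> Y \<Longrightarrow> f z = g z) \<Longrightarrow> g \<in> J"
begin

lemmas R_rules = R_const R_ident R_add R_diff[OF Y] R_mult[OF Y] R_divide_const[OF Y]
  R_sum R_power[OF Y]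

lemma J_uminus: "f \<in> J \<Longrightarrow> (\<lambda>z. - f z) \<in> J"
  using J_mult[OF R_const[of "-1"]] by simp

lemma J_diff: "f \<in> J \<Longrightarrow> g \<in> J \<Longrightarrow> (\<lambda>z. f z - g z) \<in> J"
  using J_add[OF _ J_uminus] by simp

lemma J_mult': "f \<in> J \<Longrightarrow> g \<in> R Y \<Longrightarrow> (\<lambda>z. f z * g z) \<in> J"
  using J_mult[of g f] by (simp add: mult.commute)

lemma J_divide_const: "f \<in> J \<Longrightarrow> (\<lambda>z. f z / c) \<in> J"
  using J_mult'[OF _ R_const[of "inverse c"]] by (simp add: divide_inverse)

lemma J_sum:
  assumes "finite S" "\<And>i. i \<in> S \<Longrightarrow> f i \<in> J"
  shows "(\<lambda>z. \<Sum>i\<in>S. f i z) \<in> J"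
  using assms by (induction S rule: finite_induct) (auto intro: J_0 J_add)

text \<open>Invertibility in the quotient algebra \<open>R Y / J\<close>, phrased with
  representatives. Sup norms of representatives take the place of the quotient norm.\<close>

definition inv_mod :: "(complex \<Rightarrow> complex) \<Rightarrow> (complex \<Rightarrow> complex) \<Rightarrow> bool" where
  "inv_mod f g \<longleftrightarrow> g \<in> R Y \<and> (\<lambda>z. f z * g z - 1) \<in> J"

lemma one_in_if_close:
  assumes j: "j \<in> J" and c: "\<And>y. y \<in> Y \<Longrightarrow> norm (1 - j y) < 1"
  shows "(\<lambda>z. 1) \<in> J"
proof -
  have nz: "j y \<noteq> 0" if "y \<in> Y" for y using c[OF that] by auto
  have "(\<lambda>z. 1 / j z * j z) \<in> J"
    by (rule J_mult[OF R_inverse[OF Y J_R[OF j] nz] j])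
  then show ?thesis by (rule J_cong) (use nz in auto)
qed

text \<open>For \<open>a\<close> in \<open>Y\<close>, take \<open>f\<close> in \<open>J\<close> with
  \<open>f a \<noteq> 0\<close> and a rational \<open>r\<close> near \<open>f\<close>. Then
  \<open>v = f - (r - r a)\<close> stays close to the constant \<open>f a\<close>, so it is a unit
  of \<open>R Y\<close>. As \<open>r - r a\<close> is \<open>(z - a) * s\<close>, modulo
  \<open>J\<close> the unit \<open>v\<close> equals \<open>- (z - a) * s\<close>, and
  \<open>z - a\<close> is invertible.\<close>

lemma linear_inv_mod:
  assumes nz: "\<And>a. a \<in> Y \<Longrightarrow> \<exists>f\<in>J. f a \<noteq> 0"
  shows "\<exists>u. inv_mod (\<lambda>z. z - a) u"
proof (cases "a \<in> Y")
  case False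
  then have "(\<lambda>z. 1 / (z - a)) \<in> R Y"
    by (intro R_inverse Y R_rules) auto
  moreover have "(\<lambda>z. (z - a) * (1 / (z - a)) - 1) \<in> J"
    by (rule J_cong[OF J_0]) (use False in auto)
  ultimately show ?thesis unfolding inv_mod_def by blast
next
  case True
  then obtain f where f: "f \<in> J" "f a \<noteq> 0" using nz by blast
  define e where "e = norm (f a) / 4"
  have e: "e > 0" using f by (simp add: e_def)
  obtain r where r: "r \<in> rational_without_poles_on Y" "\<And>z. z \<in> Y \<Longrightarrow> norm (f z - r z) < e"
    using R_approx[OF J_R[OF f(1)] e] by blast
  obtain p q where pq: "r = (\<lambda>z. poly p z / poly q z)" "\<forall>z\<in>Y. poly q z \<noteq> 0"
    using r(1) unfolding rational_without_poles_on_def by blast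
  have "norm (poly q a) > 0" using pq True by simp
  then have "\<exists>L>0. \<forall>b. norm b \<le> norm a \<and> norm (poly q a) \<le> norm (poly q b) \<longrightarrow>
      (\<exists>s\<in>rational_without_poles_on Y.
      \<forall>z\<in>Y. (z - b) * s z = poly p z / poly q z - poly p b / poly q b \<and> norm (s z) \<le> L)"
    using pq(2) by (intro rational_diff_quotient[OF Y]) auto
  then obtain s where s: "s \<in> rational_without_poles_on Y" "\<And>z. z \<in> Y \<Longrightarrow> (z - a) * s z = r z - r a"
    unfolding pq by auto
  define v where "v = (\<lambda>z. f z - (z - a) * s z)"
  have v: "v \<in> R Y" unfolding v_def
    by (intro R_rules J_R f rational_in_R s)
  have v0: "v z \<noteq> 0" if z: "z \<in> Y" for z
  proof
    assume "v z = 0"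
    then have "f a = (f a - r a) - (f z - r z)"
      using s(2)[OF z] by (simp add: v_def)
    then have "norm (f a) \<le> norm (f a - r a) + norm (f z - r z)"
      by (metis norm_triangle_ineq4)
    then show False using r(2)[OF z] r(2)[OF True] e unfolding e_def by linarith
  qed
  define u where "u = (\<lambda>z. - 1 * (s z * (1 / v z)))"
  have u: "u \<in> R Y" unfolding u_def
    by (intro R_rules R_inverse[OF Y] v v0 rational_in_R s)
  have "(\<lambda>z. f z * (-1 * (1 / v z))) \<in> J"
    by (intro J_mult'[OF f(1)] R_rules R_inverse[OF Y] v v0)
  then have "(\<lambda>z. (z - a) * u z - 1) \<in> J"
  proof (rule J_cong)
    fix z assume z: "z \<in> Y"
    have "f z = v z + (z - a) * s z" by (simp add: v_def)
    then show "f z * (-1 * (1 / v z)) = (z - a) * u z - 1"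
      using v0[OF z] by (simp add: u_def field_simps)
  qed
  with u show ?thesis unfolding inv_mod_def by blast
qed

text \<open>An inverse at \<open>a\<close> bounded by \<open>M\<close> yields inverses bounded by
  \<open>2 * M\<close> on a disc of radius \<open>1 / (2 * M)\<close> around \<open>a\<close>.
  Compactness of \<open>cball 0 L\<close> then leaves finitely many bounds, which their sum
  dominates.\<close>

lemma linear_inv_mod_bounded:
  assumes nz: "\<And>a. a \<in> Y \<Longrightarrow> \<exists>f\<in>J. f a \<noteq> 0"
  shows "\<exists>M>0. \<forall>a\<in>cball 0 L. \<exists>u. inv_mod (\<lambda>z. z - a) u \<and> (\<forall>y\<in>Y. norm (u y) \<le> M)"
proof -
  have "\<exists>M>0. \<forall>\<mu>\<in>ball a (1 / M). \<exists>u. inv_mod (\<lambda>z. z - \<mu>) u \<and> (\<forall>y\<in>Y. norm (u y) \<le> M)" for a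
  proof -
    obtain u where u: "u \<in> R Y" "(\<lambda>z. (z - a) * u z - 1) \<in> J"
      using linear_inv_mod[OF nz] unfolding inv_mod_def by blast
    obtain M where M: "M > 0" "\<And>y. y \<in> Y \<Longrightarrow> norm (u y) \<le> M"
      using R_bounded[OF Y u(1)] by blast
    have "\<exists>u. inv_mod (\<lambda>z. z - \<mu>) u \<and> (\<forall>y\<in>Y. norm (u y) \<le> 2 * M)" if \<mu>: "\<mu> \<in> ball a (1 / (2 * M))" for \<mu>
    proof -
      define d where "d = (\<lambda>z. 1 - (\<mu> - a) * u z)"
      have d: "d \<in> R Y" unfolding d_def by (intro R_rules u)
      have d2: "norm (d y) \<ge> 1 / 2" if "y \<in> Y" for y
      proof -
        have "norm ((\<mu> - a) * u y) \<le> 1 / (2 * M) * M"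
          unfolding norm_mult using \<mu> M(1) M(2)[OF that]
          by (intro mult_mono) (auto simp: dist_norm norm_minus_commute)
        then show ?thesis
          using M(1) norm_triangle_ineq2[of 1 "(\<mu> - a) * u y"] by (simp add: d_def)
      qed
      then have d0: "d y \<noteq> 0" if "y \<in> Y" for y using that by fastforce
      \<comment> \<open>From \<open>z - \<mu> = (z - a) - (\<mu> - a)\<close>: multiplying by
        \<open>u\<close> gives \<open>d\<close> modulo \<open>J\<close>, so \<open>u / d\<close>
        inverts \<open>z - \<mu>\<close>.\<close>
      define w where "w = (\<lambda>z. u z * (1 / d z))"
      have w: "w \<in> R Y" unfolding w_def by (intro R_rules u R_inverse[OF Y] d d0)
      have "(\<lambda>z. ((z - a) * u z - 1) * (1 / d z)) \<in> J"
        by (intro J_mult' u R_inverse[OF Y] d d0)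
      then have "(\<lambda>z. (z - \<mu>) * w z - 1) \<in> J"
        by (rule J_cong) (use d0 in \<open>auto simp: w_def field_simps, auto simp: d_def algebra_simps\<close>)
      moreover have "norm (w y) \<le> 2 * M" if "y \<in> Y" for y
      proof -
        have "norm (w y) = norm (u y) / norm (d y)" by (simp add: w_def norm_divide)
        also have "\<dots> \<le> M / (1 / 2)" using M(1) M(2)[OF that] d2[OF that] by (intro frac_le) auto
        finally show ?thesis by simp
      qed
      ultimately show ?thesis using w unfolding inv_mod_def by blast
    qed
    then show ?thesis using M(1) by (intro exI[of _ "2 * M"]) auto
  qed
  then obtain M where M: "\<And>a. M a > 0"
    "\<And>a \<mu>. \<mu> \<in> ball a (1 / M a) \<Longrightarrow> \<exists>u. inv_mod (\<lambda>z. z - \<mu>) u \<and> (\<forall>y\<in>Y. norm (u y) \<le> M a)"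
    by metis
  have "cball 0 L \<subseteq> (\<Union>a\<in>cball 0 L. ball a (1 / M a))" using M(1) by fastforce
  then obtain C where C: "C \<subseteq> cball 0 L" "finite C" "cball 0 L \<subseteq> (\<Union>a\<in>C. ball a (1 / M a))"
    using compactE_image[OF compact_cball, of "cball 0 L" "\<lambda>a. ball a (1 / M a)" 0 L] by auto
  define B where "B = 1 + (\<Sum>a\<in>C. M a)"
  have "B > 0" unfolding B_def using M(1) by (intro add_pos_nonneg sum_nonneg) (auto intro: less_imp_le)
  moreover have "\<exists>u. inv_mod (\<lambda>z. z - \<mu>) u \<and> (\<forall>y\<in>Y. norm (u y) \<le> B)" if mu: "\<mu> \<in> cball 0 L" for \<mu>
  proof -
    obtain a where l: "a \<in> C" "\<mu> \<in> ball a (1 / M a)" using C(3) mu by blast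
    have "M a \<le> (\<Sum>a\<in>C. M a)"
      using l C M(1) by (intro member_le_sum) (auto intro: less_imp_le)
    then have "M a \<le> B" by (simp add: B_def)
    with M(2)[OF l(2)] show ?thesis by force
  qed
  ultimately show ?thesis by blast
qed

text \<open>Modulo \<open>J\<close>, \<open>- (t n k * u k z)\<close> stands for
  \<open>t n k / (t n k - z)\<close>. The identity of \<open>sum_roots_of_unity_resolvent\<close>
  therefore persists, with every error a multiple of some \<open>(z - t n k) * u k z - 1\<close> in
  \<open>J\<close>.\<close>

lemma roots_average_inv_mod:
  fixes \<rho> :: real
  defines "t \<equiv> \<lambda>n k. of_real \<rho> * cis (2 * pi / real n) ^ k"
  assumes n: "n > 0" and \<rho>: "\<rho> > 0"
    and u: "\<And>k. inv_mod (\<lambda>z. z - t n k) (u k)"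
  shows "inv_mod (\<lambda>z. 1 - (z / of_real \<rho>) ^ n) (\<lambda>z. (\<Sum>k<n. - (t n k * u k z)) / of_nat n)"
  unfolding inv_mod_def
proof
  have uR: "u k \<in> R Y" "(\<lambda>z. (z - t n k) * u k z - 1) \<in> J" for k using u by (auto simp: inv_mod_def)
  have "(\<lambda>z. \<Sum>k<n. (-1) * (t n k * u k z)) \<in> R Y"
    by (intro R_rules uR finite_lessThan)
  then show "(\<lambda>z. (\<Sum>k<n. - (t n k * u k z)) / of_nat n) \<in> R Y"
    using R_divide_const[OF Y] by simp
  define S where "S = (\<lambda>k z. \<Sum>l<n. (z / t n k) ^ l)"
  have S: "S k \<in> R Y" for k unfolding S_def by (intro R_rules finite_lessThan)
  have t0: "t n k \<noteq> 0" for k using \<rho> by (simp add: t_def)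
  have tn: "(z / t n k) ^ n = (z / of_real \<rho>) ^ n" for k z
  proof -
    have "t n k ^ n = of_real \<rho> ^ n * (cis (2 * pi / real n) ^ n) ^ k"
      by (simp add: t_def power_mult_distrib mult.commute flip: power_mult)
    then have "t n k ^ n = of_real \<rho> ^ n"
      by (simp only: cis_root_of_unity[OF n] power_one mult_1_right)
    then show ?thesis by (simp add: power_divide)
  qed
  have *: "(1 - (z / of_real \<rho>) ^ n) * (- (t n k * u k z)) = S k z + ((z - t n k) * u k z - 1) * S k z" for k z
  proof -
    have A: "1 - (z / of_real \<rho>) ^ n = (1 - z / t n k) * S k z"
      using one_diff_power_eq[of "z / t n k" n] tn[of z k] by (simp add: S_def)
    have B: "(1 - z / t n k) * (- (t n k * u k z)) = (z - t n k) * u k z"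
      using t0[of k] by (simp add: field_simps)
    have "(1 - (z / of_real \<rho>) ^ n) * (- (t n k * u k z)) = ((1 - z / t n k) * (- (t n k * u k z))) * S k z"
      unfolding A by (simp only: mult_ac)
    also have "\<dots> = S k z + ((z - t n k) * u k z - 1) * S k z"
      unfolding B by (simp add: algebra_simps)
    finally show ?thesis .
  qed
  have "(\<lambda>z. (\<Sum>k<n. ((z - t n k) * u k z - 1) * S k z) / of_nat n) \<in> J"
    by (intro J_divide_const J_sum J_mult' uR S finite_lessThan)
  then show "(\<lambda>z. (1 - (z / of_real \<rho>) ^ n) * ((\<Sum>k<n. - (t n k * u k z)) / of_nat n) - 1) \<in> J"
  proof (rule J_cong)
    fix z
    have "(\<Sum>k<n. S k z) = of_nat n"
      unfolding S_def t_def by (rule sum_roots_of_unity_geometric[OF n \<rho>])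
    then have "(1 - (z / of_real \<rho>) ^ n) * (\<Sum>k<n. - (t n k * u k z))
        = of_nat n + (\<Sum>k<n. ((z - t n k) * u k z - 1) * S k z)"
      unfolding sum_distrib_left * sum.distrib by simp
    then show "(\<Sum>k<n. ((z - t n k) * u k z - 1) * S k z) / of_nat n
        = (1 - (z / of_real \<rho>) ^ n) * ((\<Sum>k<n. - (t n k * u k z)) / of_nat n) - 1"
      using n by (simp add: field_simps)
  qed
qed

text \<open>That is, the spectral radius of \<open>z\<close> modulo \<open>J\<close> is less than \<open>\<rho>\<close>.\<close>

definition contracted :: "real \<Rightarrow> bool" where
  "contracted \<rho> \<longleftrightarrow> (\<exists>n>0. \<exists>j\<in>J. \<forall>y\<in>Y. norm ((y / of_real \<rho>) ^ n - j y) \<le> 1 / 5)"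

text \<open>
  The average over the \<open>n\<close>-th roots of unity of the resolvents at radius \<open>\<rho>\<close> inverts
  \<open>1 - (z / \<rho>)\<^sup>n\<close> modulo \<open>J\<close>, and it is Lipschitz in \<open>\<rho>\<close> uniformly in \<open>n\<close>. The step from \<open>\<rho>\<close> to \<open>\<rho>'\<close> therefore
  has a length that does not depend on \<open>n\<close>.
\<close>

lemma contracted_descend:
  fixes \<rho> \<rho>' :: real
  assumes \<rho>: "0 < \<rho>'" "\<rho>' \<le> \<rho>" "\<rho> \<le> L"
    and u: "\<And>a. norm a \<le> L \<Longrightarrow> inv_mod (\<lambda>z. z - a) (u a) \<and> (\<forall>y\<in>Y. norm (u a y) \<le> M)"
    and B: "\<And>y. y \<in> Y \<Longrightarrow> norm y \<le> B" and M0: "0 \<le> M" and B0: "0 \<le> B"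
    and d: "B * M\<^sup>2 * (\<rho> - \<rho>') \<le> 1 / 12"
    and Q: "contracted \<rho>"
  shows "contracted \<rho>'"
proof -
  obtain n j where n: "n > 0" and j: "j \<in> J" "\<And>y. y \<in> Y \<Longrightarrow> norm ((y / of_real \<rho>) ^ n - j y) \<le> 1 / 5"
    using Q unfolding contracted_def by blast
  define \<omega> where "\<omega> = cis (2 * pi / real n)"
  define t where "t = (\<lambda>k. of_real \<rho> * \<omega> ^ k)"
  define t' where "t' = (\<lambda>k. of_real \<rho>' * \<omega> ^ k)"
  have n\<omega>: "norm (\<omega> ^ k) = 1" for k by (simp add: \<omega>_def norm_power)
  have tL: "norm (t k) \<le> L" "norm (t' k) \<le> L" for k
    using \<rho> n\<omega> by (auto simp: t_def t'_def norm_mult)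
  have tt: "norm (t' k - t k) = \<rho> - \<rho>'" for k
  proof -
    have "t' k - t k = of_real (\<rho>' - \<rho>) * \<omega> ^ k" by (simp add: t_def t'_def algebra_simps)
    then have "norm (t' k - t k) = norm (of_real (\<rho>' - \<rho>) :: complex) * norm (\<omega> ^ k)"
      by (simp only: norm_mult)
    then show ?thesis using \<rho> n\<omega> by (simp only: norm_of_real mult_1_right)
  qed
  define g where "g = (\<lambda>z. (\<Sum>k<n. - (t k * u (t k) z)) / of_nat n)"
  define g' where "g' = (\<lambda>z. (\<Sum>k<n. - (t' k * u (t' k) z)) / of_nat n)"
  have g: "inv_mod (\<lambda>z. 1 - (z / of_real \<rho>) ^ n) g"
    unfolding g_def t_def \<omega>_def
    by (rule roots_average_inv_mod) (use n \<rho> u tL in \<open>auto simp: t_def \<omega>_def\<close>)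
  have g': "inv_mod (\<lambda>z. 1 - (z / of_real \<rho>') ^ n) g'"
    unfolding g'_def t'_def \<omega>_def
    by (rule roots_average_inv_mod) (use n \<rho> u tL in \<open>auto simp: t'_def \<omega>_def\<close>)
  have uR: "u (t k) \<in> R Y" "u (t' k) \<in> R Y"
    and uJ: "(\<lambda>z. (z - t k) * u (t k) z - 1) \<in> J" "(\<lambda>z. (z - t' k) * u (t' k) z - 1) \<in> J"
    and uM: "\<And>y. y \<in> Y \<Longrightarrow> norm (u (t k) y) \<le> M" "\<And>y. y \<in> Y \<Longrightarrow> norm (u (t' k) y) \<le> M" for k
    using u tL unfolding inv_mod_def by blast+
  define e where "e = (\<lambda>k z. (z - t k) * u (t k) z - 1)"
  define e' where "e' = (\<lambda>k z. (z - t' k) * u (t' k) z - 1)"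
  \<comment> \<open>The resolvent identity \<open>t' / (t' - z) - t / (t - z) = z * (t - t') / ((t'
    - z) * (t - z))\<close> holds for the representatives up to this explicit element of
    \<open>J\<close>.\<close>
  define i where "i = (\<lambda>k z. (e' k z - e k z) + z * (u (t' k) z * e k z - u (t k) z * e' k z))"
  have i: "i k \<in> J" for k
    unfolding i_def e_def e'_def by (intro J_add J_diff J_mult R_rules uR uJ)
  have vi: "- (t' k * u (t' k) z) - (- (t k * u (t k) z)) - i k z = z * u (t k) z * u (t' k) z * (t k - t' k)" for k z
    unfolding i_def e_def e'_def by (simp add: algebra_simps)
  define i0 where "i0 = (\<lambda>z. (\<Sum>k<n. i k z) / of_nat n)"
  have i0: "i0 \<in> J" unfolding i0_def by (intro J_divide_const J_sum i finite_lessThan)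
  have gg: "norm (g' y - g y - i0 y) \<le> 1 / 12" if y: "y \<in> Y" for y
  proof -
    have A: "g' y - g y - i0 y = (\<Sum>k<n. y * u (t k) y * u (t' k) y * (t k - t' k)) / of_nat n"
      unfolding g_def g'_def i0_def vi[symmetric] by (simp add: sum_subtractf sum_negf diff_divide_distrib)
    have B: "norm (\<Sum>k<n. y * u (t k) y * u (t' k) y * (t k - t' k)) \<le> (\<Sum>k<n. 1 / 12)"
    proof (rule sum_norm_le)
      fix k
      have "norm (y * u (t k) y * u (t' k) y * (t k - t' k)) \<le> B * M * M * (\<rho> - \<rho>')"
        unfolding norm_mult using B[OF y] uM[OF y] M0 B0 tt[of k] \<rho>
        by (intro mult_mono) (auto simp: norm_minus_commute)
      then show "norm (y * u (t k) y * u (t' k) y * (t k - t' k)) \<le> 1 / 12"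
        using d unfolding power2_eq_square mult.assoc by linarith
    qed
    show ?thesis unfolding A norm_divide using B n by (simp add: pos_divide_le_eq)
  qed
  \<comment> \<open>\<open>D\<close> represents \<open>1 - (z / \<rho>) ^ n\<close> modulo
    \<open>J\<close> and is bounded away from 0. Inverses modulo \<open>J\<close> being unique,
    \<open>g\<close> agrees with \<open>1 / D\<close>.\<close>
  define D where "D = (\<lambda>z. 1 - ((z / of_real \<rho>) ^ n - j z))"
  have D: "D \<in> R Y" unfolding D_def by (intro R_rules J_R j)
  have Dn: "norm (D y) \<ge> 4 / 5" if "y \<in> Y" for y
    using norm_triangle_ineq2[of 1 "(y / of_real \<rho>) ^ n - j y"] j(2)[OF that] by (simp add: D_def)
  then have D0: "D y \<noteq> 0" if "y \<in> Y" for y using that by fastforce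
  have gR: "g \<in> R Y" "(\<lambda>z. (1 - (z / of_real \<rho>) ^ n) * g z - 1) \<in> J" using g by (auto simp: inv_mod_def)
  have "(\<lambda>z. (((1 - (z / of_real \<rho>) ^ n) * g z - 1) + j z * g z) * (1 / D z)) \<in> J"
    by (intro J_mult' J_add gR j R_inverse[OF Y] D D0)
  then have gD: "(\<lambda>z. g z - 1 / D z) \<in> J"
  proof (rule J_cong)
    fix z assume z: "z \<in> Y"
    have *: "((1 - (z / of_real \<rho>) ^ n) * g z - 1) + j z * g z = g z * D z - 1"
      by (simp add: D_def algebra_simps)
    show "(((1 - (z / of_real \<rho>) ^ n) * g z - 1) + j z * g z) * (1 / D z) = g z - 1 / D z"
      unfolding * using D0[OF z] by (simp add: diff_divide_distrib)
  qed
  \<comment> \<open>A representative of \<open>g'\<close> that is close to 1: the distance is at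
    most \<open>1 / 4\<close> from \<open>1 / D\<close> plus \<open>1 / 12\<close> from the change
    of radius.\<close>
  define H where "H = (\<lambda>z. g' z - (i0 z + (g z - 1 / D z)))"
  have jH: "(\<lambda>z. i0 z + (g z - 1 / D z)) \<in> J" by (intro J_add i0 gD)
  have g'R: "g' \<in> R Y" "(\<lambda>z. (1 - (z / of_real \<rho>') ^ n) * g' z - 1) \<in> J" using g' by (auto simp: inv_mod_def)
  have HR: "H \<in> R Y" unfolding H_def by (intro R_diff[OF Y] g'R J_R jH)
  have H1: "norm (1 - H y) \<le> 1 / 3" if y: "y \<in> Y" for y
  proof -
    have "1 - H y = (1 - 1 / D y) - (g' y - g y - i0 y)" by (simp add: H_def)
    then have "norm (1 - H y) \<le> norm (1 - 1 / D y) + norm (g' y - g y - i0 y)"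
      by (metis norm_triangle_ineq4)
    moreover have "norm (1 - 1 / D y) \<le> 1 / 4"
    proof -
      have "1 - 1 / D y = - (((y / of_real \<rho>) ^ n - j y) / D y)"
      proof -
        have "(y / of_real \<rho>) ^ n - j y = 1 - D y" by (simp add: D_def)
        then show ?thesis using D0[OF y] by (simp add: diff_divide_distrib)
      qed
      then have "norm (1 - 1 / D y) = norm ((y / of_real \<rho>) ^ n - j y) / norm (D y)"
        by (simp only: norm_minus_cancel norm_divide)
      also have "\<dots> \<le> (1 / 5) / (4 / 5)" by (intro frac_le j(2) Dn y) auto
      finally show ?thesis by simp
    qed
    ultimately show ?thesis using gg[OF y] by simp
  qed
  have Hn: "norm (H y) \<ge> 2 / 3" if y: "y \<in> Y" for y
    using norm_triangle_ineq2[of 1 "1 - H y"] H1[OF y] by simp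
  then have H0: "H y \<noteq> 0" if "y \<in> Y" for y using that by fastforce
  \<comment> \<open>Since \<open>H\<close> inverts \<open>1 - w\<close> modulo \<open>J\<close>,
    \<open>w\<close> is congruent to \<open>1 - 1 / H\<close>, whose norm is at most
    \<open>(1 / 3) / (2 / 3)\<close>.\<close>
  define K where "K = (\<lambda>z. 1 - 1 / H z)"
  have KR: "K \<in> R Y" unfolding K_def by (intro R_rules R_inverse[OF Y] HR H0)
  have Kn: "norm (K y) \<le> 1 / 2" if y: "y \<in> Y" for y
  proof -
    have "K y = - ((1 - H y) / H y)" using H0[OF y] by (simp add: K_def field_simps)
    then have "norm (K y) = norm (1 - H y) / norm (H y)" by (simp only: norm_minus_cancel norm_divide)
    also have "\<dots> \<le> (1 / 3) / (2 / 3)" by (intro frac_le H1 Hn y) auto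
    finally show ?thesis by simp
  qed
  define w where "w = (\<lambda>z :: complex. (z / of_real \<rho>') ^ n)"
  have wR: "w \<in> R Y" unfolding w_def by (intro R_rules)
  have h1: "(\<lambda>z. (1 - w z) * g' z - 1) \<in> J" using g'R(2) by (simp add: w_def)
  have h2: "(\<lambda>z. 1 - w z) \<in> R Y" by (intro R_rules wR)
  have h3: "(\<lambda>z. - 1 / H z) \<in> R Y" using R_mult[OF Y R_const[of "-1"] R_inverse[OF Y HR H0]] by simp
  have "(\<lambda>z. (((1 - w z) * g' z - 1) - (1 - w z) * (i0 z + (g z - 1 / D z))) * (- 1 / H z)) \<in> J"
    by (rule J_mult'[OF J_diff[OF h1 J_mult[OF h2 jH]] h3])
  then have wK: "(\<lambda>z. w z - K z) \<in> J"
  proof (rule J_cong)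
    fix z assume "z \<in> Y"
    have *: "((1 - w z) * g' z - 1) - (1 - w z) * (i0 z + (g z - 1 / D z)) = (1 - w z) * H z - 1"
      unfolding H_def by (simp add: algebra_simps)
    show "(((1 - w z) * g' z - 1) - (1 - w z) * (i0 z + (g z - 1 / D z))) * (- 1 / H z) = w z - K z"
      unfolding * using H0[OF \<open>z \<in> Y\<close>] by (simp add: K_def field_simps)
  qed
  \<comment> \<open>The bound \<open>1 / 2\<close> for \<open>K\<close> is weaker than the
    \<open>1 / 5\<close> that \<open>contracted\<close> asks for. Cubing repairs this:
    \<open>w ^ 3 - K ^ 3\<close> is in \<open>J\<close> and
    \<open>1 / 8 \<le> 1 / 5\<close>.\<close>
  have "(\<lambda>z. (w z - K z) * (w z * w z + w z * K z + K z * K z)) \<in> J"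
    by (intro J_mult' wK R_rules wR KR)
  moreover have "norm ((y / of_real \<rho>') ^ (n * 3) - (w y - K y) * (w y * w y + w y * K y + K y * K y)) \<le> 1 / 5"
    if y: "y \<in> Y" for y
  proof -
    have "(y / of_real \<rho>') ^ (n * 3) = w y * w y * w y"
      by (simp add: w_def power_mult power3_eq_cube)
    then have "(y / of_real \<rho>') ^ (n * 3) - (w y - K y) * (w y * w y + w y * K y + K y * K y) = K y ^ 3"
      by (simp add: power3_eq_cube algebra_simps)
    moreover have "norm (K y ^ 3) \<le> (1 / 2) ^ 3"
      unfolding norm_power by (intro power_mono Kn y) auto
    ultimately show ?thesis by (simp add: power3_eq_cube)
  qed
  ultimately show ?thesis
    unfolding contracted_def using n by (intro exI[of _ "n * 3"] conjI bexI) auto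
qed

text \<open>If \<open>z - a\<close> is invertible modulo \<open>J\<close> for every
  \<open>a\<close>, contraction passes from a large radius down to \<open>1 / M\<close> in steps of
  fixed length. There it contradicts the invertibility of \<open>z\<close> unless \<open>1\<close>
  is in \<open>J\<close>: multiplying \<open>(z / \<rho>) ^ n\<close> by
  \<open>(\<rho> * u 0 z) ^ n\<close>, of norm at most 1, gives 1 modulo \<open>J\<close>, but also
  something small.\<close>

theorem one_in:
  assumes nz: "\<And>a. a \<in> Y \<Longrightarrow> \<exists>f\<in>J. f a \<noteq> 0"
  shows "(\<lambda>z. 1) \<in> J"
proof -
  obtain B where B: "B > 0" "\<And>y. y \<in> Y \<Longrightarrow> norm y \<le> B"
    using R_bounded[OF Y R_ident] by blast
  define L where "L = 5 * B"
  have L: "L > 0" using B by (simp add: L_def)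
  obtain M1 where M1: "M1 > 0"
    "\<forall>a\<in>cball 0 L. \<exists>u. inv_mod (\<lambda>z. z - a) u \<and> (\<forall>y\<in>Y. norm (u y) \<le> M1)"
    using linear_inv_mod_bounded[OF nz] by blast
  then have "\<forall>a. \<exists>u. norm a \<le> L \<longrightarrow> inv_mod (\<lambda>z. z - a) u \<and> (\<forall>y\<in>Y. norm (u y) \<le> M1)"
    by (auto simp: mem_cball_0)
  then obtain u where u1: "\<And>a. norm a \<le> L \<Longrightarrow> inv_mod (\<lambda>z. z - a) (u a) \<and> (\<forall>y\<in>Y. norm (u a y) \<le> M1)"
    by metis
  \<comment> \<open>The maximum ensures that the final radius \<open>1 / M\<close> does not exceed
    \<open>L\<close>.\<close>
  define M where "M = max M1 (1 / L)"
  have M: "M > 0" using M1 by (simp add: M_def)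
  have u: "inv_mod (\<lambda>z. z - a) (u a) \<and> (\<forall>y\<in>Y. norm (u a y) \<le> M)" if "norm a \<le> L" for a
    using u1[OF that] by (force simp: M_def)
  \<comment> \<open>The longest step that \<open>contracted_descend\<close> permits:
    \<open>B * M\<^sup>2 * d = 1 / 12\<close>.\<close>
  define d where "d = 1 / (12 * B * M\<^sup>2)"
  have d: "d > 0" using B M by (simp add: d_def)
  have "contracted L"
    unfolding contracted_def
  proof (intro exI[of _ "1::nat"] conjI bexI[of _ "\<lambda>z. 0"] J_0 ballI)
    fix y assume "y \<in> Y"
    have "norm (y / of_real L) \<le> B / L"
      using B(2)[OF \<open>y \<in> Y\<close>] L by (simp add: norm_divide divide_right_mono)
    then show "norm ((y / of_real L) ^ 1 - 0) \<le> 1 / 5" using B by (simp add: L_def)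
  qed simp
  have desc: "L - real m * d \<le> \<rho> \<Longrightarrow> 0 < \<rho> \<Longrightarrow> \<rho> \<le> L \<Longrightarrow> contracted \<rho>" for m \<rho>
  proof (induction m arbitrary: \<rho>)
    case 0
    then show ?case using \<open>contracted L\<close> by simp
  next
    case (Suc m)
    define \<rho>1 where "\<rho>1 = min L (\<rho> + d)"
    have "contracted \<rho>1"
      by (rule Suc.IH) (use Suc.prems d L in \<open>auto simp: \<rho>1_def algebra_simps min_def\<close>)
    moreover have "B * M\<^sup>2 * (\<rho>1 - \<rho>) \<le> B * M\<^sup>2 * d"
      using B M by (intro mult_left_mono) (auto simp: \<rho>1_def)
    moreover have "B * M\<^sup>2 * d = 1 / 12" using B M by (simp add: d_def)
    ultimately show ?case
      using Suc.prems d B M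
      by (intro contracted_descend[OF _ _ _ u, of \<rho> \<rho>1 L B]) (auto simp: \<rho>1_def)
  qed
  define \<rho> where "\<rho> = 1 / M"
  have \<rho>: "\<rho> > 0" "\<rho> \<le> L"
    using M L by (auto simp: \<rho>_def M_def field_simps max_def)
  obtain m where "L / d < real m" using reals_Archimedean2 by blast
  then have "L - real m * d \<le> \<rho>" using d \<rho> by (simp add: field_simps)
  then obtain n j where n: "n > 0" and j: "j \<in> J" "\<And>y. y \<in> Y \<Longrightarrow> norm ((y / of_real \<rho>) ^ n - j y) \<le> 1 / 5"
    using desc[OF _ \<rho>] unfolding contracted_def by blast
  have u0: "u 0 \<in> R Y" "(\<lambda>z. z * u 0 z - 1) \<in> J" "\<And>y. y \<in> Y \<Longrightarrow> norm (u 0 y) \<le> M"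
    using u[of 0] L by (auto simp: inv_mod_def)
  define w where "w = (\<lambda>z. of_real \<rho> * u 0 z)"
  have wR: "w \<in> R Y" unfolding w_def by (intro R_rules u0)
  define S where "S = (\<lambda>z. \<Sum>i<n. (z * u 0 z) ^ i)"
  have "(\<lambda>z. j z * w z ^ n - (z * u 0 z - 1) * S z) \<in> J"
    unfolding S_def by (intro J_diff J_mult' j u0 R_rules wR finite_lessThan)
  then show ?thesis
  proof (rule one_in_if_close)
    fix y assume y: "y \<in> Y"
    have "(z * u 0 z - 1) * S z = (z * u 0 z) ^ n - 1" for z
      unfolding S_def by (simp add: power_diff_1_eq)
    moreover have "(y * u 0 y) ^ n = (y / of_real \<rho>) ^ n * w y ^ n"
      using \<rho> by (simp add: w_def flip: power_mult_distrib)
    ultimately have "1 - (j y * w y ^ n - (y * u 0 y - 1) * S y) = ((y / of_real \<rho>) ^ n - j y) * w y ^ n"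
      by (simp add: algebra_simps)
    also have "norm \<dots> \<le> 1 / 5 * 1"
    proof -
      have "norm (w y) \<le> \<rho> * M" unfolding w_def norm_mult using \<rho> u0(3)[OF y] by simp
      then have "norm (w y) \<le> 1" using M by (simp add: \<rho>_def)
      then have "norm (w y ^ n) \<le> 1" unfolding norm_power by (intro power_le_one) auto
      then show ?thesis unfolding norm_mult using j(2)[OF y] by (intro mult_mono) auto
    qed
    finally show "norm (1 - (j y * w y ^ n - (y * u 0 y - 1) * S y)) < 1" by simp
  qed
qed

end

section \<open>From regularity to normality\<close>

lemma regular_on_R_normal:
  assumes Y: "compact Y" and reg: "regular_on Y (R Y)"
    and AB: "closed A" "closed B" "A \<inter> B \<inter> Y = {}"
  shows "\<exists>b\<in>R Y. (\<forall>z\<in>Y \<inter> A. b z = 1) \<and> (\<forall>z\<in>Y \<inter> B. b z = 0)"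
proof -
  \<comment> \<open>The sum of the ideals of functions vanishing on \<open>A\<close> and on
    \<open>B\<close>. A point of \<open>Y\<close> misses one of the two sets, so regularity supplies
    an element of \<open>J\<close> that is nonzero there. A decomposition \<open>1 = a + b\<close>
    then makes \<open>b\<close> the separating function.\<close>
  define J where "J = {f. \<exists>a\<in>R Y. \<exists>b\<in>R Y. (\<forall>z\<in>Y \<inter> A. a z = 0) \<and> (\<forall>z\<in>Y \<inter> B. b z = 0) \<and>
    (\<forall>z\<in>Y. f z = a z + b z)}"
  have JI: "f \<in> J" if "a \<in> R Y" "b \<in> R Y" "\<And>z. z \<in> Y \<Longrightarrow> z \<in> A \<Longrightarrow> a z = 0"
    "\<And>z. z \<in> Y \<Longrightarrow> z \<in> B \<Longrightarrow> b z = 0" "\<And>z. z \<in> Y \<Longrightarrow> f z = a z + b z" for f a b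
    unfolding J_def using that by blast
  interpret R_ideal Y J
  proof
    show "compact Y" by fact
    show "(\<lambda>z. 0) \<in> J" by (rule JI[of "\<lambda>z. 0" "\<lambda>z. 0"]) (auto intro: R_const)
    fix f assume f: "f \<in> J"
    then obtain a b where ab: "a \<in> R Y" "b \<in> R Y" "\<forall>z\<in>Y \<inter> A. a z = 0" "\<forall>z\<in>Y \<inter> B. b z = 0"
      "\<forall>z\<in>Y. f z = a z + b z" unfolding J_def by blast
    show "f \<in> R Y" by (rule R_cong[OF R_add[OF ab(1,2)]]) (use ab in auto)
    show "(\<lambda>z. g z * f z) \<in> J" if "g \<in> R Y" for g
      by (rule JI[OF R_mult[OF Y that ab(1)] R_mult[OF Y that ab(2)]]) (use ab in \<open>auto simp: algebra_simps\<close>)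
    show "g \<in> J" if "\<And>z. z \<in> Y \<Longrightarrow> f z = g z" for g
      by (rule JI[OF ab(1,2)]) (use ab that in auto)
    fix g assume "g \<in> J"
    then obtain c d where cd: "c \<in> R Y" "d \<in> R Y" "\<forall>z\<in>Y \<inter> A. c z = 0" "\<forall>z\<in>Y \<inter> B. d z = 0"
      "\<forall>z\<in>Y. g z = c z + d z" unfolding J_def by blast
    show "(\<lambda>z. f z + g z) \<in> J"
      by (rule JI[OF R_add[OF ab(1) cd(1)] R_add[OF ab(2) cd(2)]]) (use ab cd in auto)
  qed
  have "(\<lambda>z. 1) \<in> J"
  proof (rule one_in)
    fix x assume x: "x \<in> Y"
    have 0: "(\<lambda>z. 0) \<in> R Y" by (rule R_const)
    show "\<exists>f\<in>J. f x \<noteq> 0"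
    proof (cases "x \<in> A")
      case False
      have "closed (Y \<inter> A)" using Y AB compact_imp_closed by blast
      then obtain f where f: "f \<in> R Y" "f x = 1" "\<forall>y\<in>Y \<inter> A. f y = 0"
        using reg x False unfolding regular_on_def by blast
      have "f \<in> J" by (rule JI[OF f(1) 0]) (use f in auto)
      then show ?thesis using f(2) by (intro bexI[of _ f]) auto
    next
      case True
      have "closed (Y \<inter> B)" using Y AB compact_imp_closed by blast
      moreover have "x \<notin> B" using True AB x by blast
      ultimately obtain f where f: "f \<in> R Y" "f x = 1" "\<forall>y\<in>Y \<inter> B. f y = 0"
        using reg x unfolding regular_on_def by blast
      have "f \<in> J" by (rule JI[OF 0 f(1)]) (use f in auto)
      then show ?thesis using f(2) by (intro bexI[of _ f]) auto
    qed
  qed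
  then obtain a b where ab: "a \<in> R Y" "b \<in> R Y" "\<forall>z\<in>Y \<inter> A. a z = 0" "\<forall>z\<in>Y \<inter> B. b z = 0"
    "\<forall>z\<in>Y. 1 = a z + b z" unfolding J_def by blast
  then show ?thesis by (intro bexI[of _ b]) auto
qed

section \<open>Localization\<close>

lemma sin_ge_half:
  fixes x :: real
  assumes "0 \<le> x" "x \<le> pi / 2"
  shows "x / 2 \<le> sin x"
proof -
  \<comment> \<open>This gives \<open>y * cos y \<le> sin y\<close>. At \<open>y = x / 2\<close>,
    doubling the angle yields \<open>x * (cos (x / 2))\<^sup>2 \<le> sin x\<close>, and the squared
    cosine is at least \<open>1 / 2\<close>.\<close>
  have "(\<lambda>y. sin y - y * cos y) 0 \<le> (\<lambda>y. sin y - y * cos y) (x / 2)"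
  proof (rule DERIV_nonneg_imp_nondecreasing[where f = "\<lambda>y. sin y - y * cos y"])
    fix y assume "0 \<le> y" "y \<le> x / 2"
    then have "0 \<le> y * sin y" using assms by (intro mult_nonneg_nonneg sin_ge_zero) auto
    moreover have "((\<lambda>y. sin y - y * cos y) has_real_derivative y * sin y) (at y)"
      by (auto intro!: derivative_eq_intros)
    ultimately show "\<exists>d. ((\<lambda>y. sin y - y * cos y) has_real_derivative d) (at y) \<and> 0 \<le> d" by blast
  qed (use assms in auto)
  then have "x / 2 * cos (x / 2) \<le> sin (x / 2)" by simp
  moreover have "0 \<le> cos (x / 2)" using assms by (intro cos_ge_zero) auto
  ultimately have "2 * (x / 2 * cos (x / 2) * cos (x / 2)) \<le> 2 * (sin (x / 2) * cos (x / 2))"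
    by (intro mult_left_mono mult_right_mono) auto
  also have "\<dots> = sin x" using sin_double[of "x / 2"] by simp
  finally have "x * (cos (x / 2))\<^sup>2 \<le> sin x" by (simp add: power2_eq_square mult.assoc)
  moreover have "x / 2 \<le> x * (cos (x / 2))\<^sup>2"
  proof -
    have "0 \<le> cos x" using assms by (intro cos_ge_zero) auto
    moreover have "cos x = 2 * (cos (x / 2))\<^sup>2 - 1" using cos_double_cos[of "x / 2"] by simp
    ultimately have "1 / 2 \<le> (cos (x / 2))\<^sup>2" by simp
    then show ?thesis using mult_left_mono[of "1/2" "(cos (x / 2))\<^sup>2" x] assms by simp
  qed
  ultimately show ?thesis by simp
qed

text \<open>The chord has length \<open>2 * \<bar>sin (pi * m / n)\<bar>\<close>, which is symmetric
  under \<open>m \<mapsto> n - m\<close>. The minimum brings the angle into the range of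
  \<open>sin_ge_half\<close>.\<close>

lemma norm_cis_root_power_diff:
  fixes n m :: nat
  assumes "m \<le> n" "n > 0"
  shows "real (min m (n - m)) / real n \<le> norm (cis (2 * pi / real n) ^ m - 1)"
proof -
  define x where "x = pi * real (min m (n - m)) / real n"
  have "2 * real (min m (n - m)) \<le> real n" using assms by linarith
  then have "x \<le> pi / 2" using assms pi_gt_zero by (simp add: x_def field_simps)
  moreover have "0 \<le> x" using assms by (simp add: x_def)
  ultimately have s: "x / 2 \<le> sin x" using sin_ge_half by blast
  have "cis (2 * pi / real n) ^ m = exp (\<i> * of_real (2 * pi * real m / real n))"
    by (subst Complex.DeMoivre) (simp add: cis_conv_exp mult_ac)
  then have "norm (cis (2 * pi / real n) ^ m - 1) = 2 * \<bar>sin (pi * real m / real n)\<bar>"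
    using dist_exp_i_1[of "2 * pi * real m / real n"] by simp
  also have "sin (pi * real m / real n) = sin x"
  proof (cases "m \<le> n - m")
    case False
    then have "x = pi - pi * real m / real n"
      using assms by (simp add: x_def min_def of_nat_diff field_simps)
    then show ?thesis by simp
  qed (simp add: x_def min_def)
  also have "2 * \<bar>sin x\<bar> \<ge> x" using s by linarith
  finally have "x \<le> norm (cis (2 * pi / real n) ^ m - 1)" by simp
  moreover have "real (min m (n - m)) / real n \<le> x"
  proof -
    have "real (min m (n - m)) * 1 \<le> real (min m (n - m)) * pi"
      using pi_ge_two by (intro mult_left_mono) auto
    then show ?thesis using assms by (simp add: x_def divide_right_mono mult.commute)
  qed
  ultimately show ?thesis by linarith
qed

text \<open>Telescoping: \<open>1 / sqrt (m + 1) \<le> 2 * (sqrt (m + 1) - sqrt m)\<close> by the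
  inequality of arithmetic and geometric means.\<close>

lemma sum_inverse_sqrt_le: "(\<Sum>i<m. 1 / sqrt (real i + 1)) \<le> 2 * sqrt (real m)"
proof (induction m)
  case (Suc m)
  define a where "a = sqrt (real m)"
  define b where "b = sqrt (real m + 1)"
  have b: "b > 0" by (simp add: b_def)
  have "(b - a)\<^sup>2 \<ge> 0" by simp
  then have "2 * (a * b) \<le> a\<^sup>2 + b\<^sup>2" by (simp add: power2_eq_square algebra_simps)
  also have "\<dots> = 2 * b\<^sup>2 - 1" by (simp add: a_def b_def)
  finally have "2 * (a * b) + 1 \<le> 2 * (b * b)" by (simp add: power2_eq_square)
  then have "2 * a + 1 / b \<le> 2 * b" using b by (simp add: field_simps)
  with Suc.IH show ?case by (simp add: a_def b_def add.commute)
qed simp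

text \<open>Each distance occurs at most once on either side of \<open>k0\<close>.\<close>

lemma sum_dist_le:
  fixes f :: "nat \<Rightarrow> real"
  assumes "\<And>i. f i \<ge> 0" "k0 < n"
  shows "(\<Sum>k<n. f (nat \<bar>int k - int k0\<bar>)) \<le> 2 * (\<Sum>i\<le>n. f i)"
proof -
  have "(\<Sum>k<n. f (nat \<bar>int k - int k0\<bar>))
      = (\<Sum>k<k0. f (nat \<bar>int k - int k0\<bar>)) + (\<Sum>k\<in>{k0..<n}. f (nat \<bar>int k - int k0\<bar>))"
    using assms(2) by (subst sum.union_disjoint[symmetric]) (auto intro!: sum.cong)
  also have "(\<Sum>k<k0. f (nat \<bar>int k - int k0\<bar>)) = (\<Sum>k<k0. f (k0 - k))"
    by (intro sum.cong refl arg_cong[where f = f]) auto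
  also have "(\<Sum>k<k0. f (k0 - k)) = sum f ((\<lambda>k. k0 - k) ` {..<k0})"
    by (subst sum.reindex) (auto intro!: inj_onI)
  also have "\<dots> \<le> (\<Sum>i\<le>n. f i)"
    using assms by (intro sum_mono2) auto
  also have "(\<Sum>k\<in>{k0..<n}. f (nat \<bar>int k - int k0\<bar>)) = (\<Sum>k\<in>{k0..<n}. f (k - k0))"
    by (intro sum.cong refl arg_cong[where f = f]) auto
  also have "(\<Sum>k\<in>{k0..<n}. f (k - k0)) = sum f ((\<lambda>k. k - k0) ` {k0..<n})"
    by (subst sum.reindex) (auto intro!: inj_onI)
  also have "\<dots> \<le> (\<Sum>i\<le>n. f i)"
    using assms by (intro sum_mono2) auto
  finally show ?thesis by simp
qed

text \<open>Radius index first, angle index second. Every circle carries \<open>n\<close> nodes, so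
  by \<open>sum_roots_of_unity_resolvent\<close> the unweighted mean of \<open>a / (a - w)\<close>
  over the nodes is the mean over the radii \<open>\<rho>\<close> of
  \<open>1 / (1 - (w / \<rho>) ^ n)\<close>.\<close>

definition node :: "real \<Rightarrow> real \<Rightarrow> nat \<Rightarrow> nat \<times> nat \<Rightarrow> complex" where
  "node \<tau> h n p = of_real (\<tau> + h * real (fst p) / real n) * cis (2 * pi / real n) ^ snd p"

lemma norm_node:
  assumes "0 < \<tau>" "0 < h" "fst p < n"
  shows "norm (node \<tau> h n p) = \<tau> + h * real (fst p) / real n"
    "\<tau> \<le> norm (node \<tau> h n p)" "norm (node \<tau> h n p) \<le> \<tau> + h"
proof -
  have 0: "0 \<le> h * real (fst p) / real n" using assms by simp
  with assms show 1: "norm (node \<tau> h n p) = \<tau> + h * real (fst p) / real n"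
    unfolding node_def norm_mult norm_power by (simp add: abs_of_nonneg del: of_real_add)
  with 0 show "\<tau> \<le> norm (node \<tau> h n p)" by simp
  have "h * real (fst p) / real n \<le> h" using assms by (simp add: pos_divide_le_eq)
  then show "norm (node \<tau> h n p) \<le> \<tau> + h" using 1 by simp
qed

text \<open>The radial bound is the reverse triangle inequality. For the angular one, moving along
  the circle through the first node costs at most the distance of the nodes plus their radial
  difference, hence twice the distance; \<open>2 * h \<le> \<tau>\<close> absorbs the factor
  2.\<close>

lemma node_separation:
  fixes j j0 k k0 :: nat
  assumes \<tau>: "0 < h" "2 * h \<le> \<tau>" and n: "j < n" "j0 < n" "k < n" "k0 < n"
  defines "D \<equiv> nat \<bar>int k - int k0\<bar>" and "P \<equiv> nat \<bar>int j - int j0\<bar>"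
  shows "h * real P / real n \<le> norm (node \<tau> h n (j, k) - node \<tau> h n (j0, k0))"
    and "h * real (min D (n - D)) / real n \<le> norm (node \<tau> h n (j, k) - node \<tau> h n (j0, k0))"
proof -
  define \<omega> where "\<omega> = cis (2 * pi / real n)"
  have n\<omega>: "norm (\<omega> ^ i) = 1" for i by (simp add: \<omega>_def norm_power)
  let ?a = "node \<tau> h n (j, k)" and ?b = "node \<tau> h n (j0, k0)"
  have na: "norm ?a = \<tau> + h * real j / real n" and nb: "norm ?b = \<tau> + h * real j0 / real n"
    using norm_node(1)[of \<tau> h "(j, k)" n] norm_node(1)[of \<tau> h "(j0, k0)" n] \<tau> n by simp_all
  have "\<bar>norm ?a - norm ?b\<bar> = \<bar>h * (real j - real j0) / real n\<bar>"
    unfolding na nb by (simp add: algebra_simps diff_divide_distrib)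
  also have "\<dots> = h * real P / real n"
    using \<tau> by (simp add: P_def abs_mult)
  finally have P: "h * real P / real n = \<bar>norm ?a - norm ?b\<bar>" by simp
  then show 1: "h * real P / real n \<le> norm (?a - ?b)"
    by (simp add: norm_triangle_ineq3)
  have ang: "real (min D (n - D)) / real n \<le> norm (\<omega> ^ k - \<omega> ^ k0)"
  proof -
    have *: "norm (\<omega> ^ a - \<omega> ^ b) = norm (\<omega> ^ (a - b) - 1)" if "b \<le> a" for a b
    proof -
      have "\<omega> ^ a - \<omega> ^ b = (\<omega> ^ (a - b) - 1) * \<omega> ^ b"
        using that by (simp add: algebra_simps flip: power_add)
      then show ?thesis using n\<omega> by (simp add: norm_mult)
    qed
    have "norm (\<omega> ^ k - \<omega> ^ k0) = norm (\<omega> ^ D - 1)"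
    proof (cases "k0 \<le> k")
      case True
      then have "D = k - k0" by (simp add: D_def)
      then show ?thesis using *[OF True] by simp
    next
      case False
      then have "D = k0 - k" by (simp add: D_def)
      then show ?thesis using *[of k k0] False by (simp add: norm_minus_commute)
    qed
    then show ?thesis
      using norm_cis_root_power_diff[of D n] n unfolding \<omega>_def D_def by simp
  qed
  have "?a - ?b = of_real (norm ?a) * (\<omega> ^ k - \<omega> ^ k0) + of_real (norm ?a - norm ?b) * \<omega> ^ k0"
    unfolding na nb by (simp add: node_def \<omega>_def algebra_simps)
  then have "norm ?a * norm (\<omega> ^ k - \<omega> ^ k0) - \<bar>norm ?a - norm ?b\<bar> \<le> norm (?a - ?b)"
    using norm_diff_ineq[of "of_real (norm ?a) * (\<omega> ^ k - \<omega> ^ k0)" "of_real (norm ?a - norm ?b) * \<omega> ^ k0"]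
    by (simp add: norm_mult n\<omega> del: of_real_diff)
  then have "norm ?a * norm (\<omega> ^ k - \<omega> ^ k0) \<le> 2 * norm (?a - ?b)"
    using norm_triangle_ineq3[of ?a ?b] by linarith
  moreover have "2 * h * (real (min D (n - D)) / real n) \<le> norm ?a * norm (\<omega> ^ k - \<omega> ^ k0)"
    using ang \<tau> norm_node(2)[of \<tau> h "(j, k)" n] n by (intro mult_mono) auto
  ultimately show "h * real (min D (n - D)) / real n \<le> norm (?a - ?b)" by simp
qed

text \<open>
  The discrete form of the uniform boundedness of the area integral of \<open>1 / \<bar>z - w\<bar>\<close>. With \<open>p0\<close> the node
  nearest to \<open>w\<close>, the distance of a node to \<open>w\<close> is at least half its distance to \<open>p0\<close>, and the
  inequality \<open>1 / max P D \<le> 2 / (sqrt (P + 1) * sqrt (D + 1))\<close> separates the radial and angular variables.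
\<close>

lemma node_kernel_sum:
  assumes h: "0 < h" "2 * h \<le> \<tau>" and n: "n > 0"
  shows "\<exists>p0\<in>{..<n} \<times> {..<n}. (\<forall>p\<in>{..<n} \<times> {..<n} - {p0}. node \<tau> h n p \<noteq> w) \<and>
      (\<Sum>p\<in>{..<n} \<times> {..<n} - {p0}. 1 / norm (node \<tau> h n p - w)) \<le> 256 * (real n)\<^sup>2 / h"
proof -
  define S where "S = {..<n} \<times> {..<n}"
  have S: "finite S" "S \<noteq> {}" using n by (auto simp: S_def)
  \<comment> \<open>\<open>w\<close> may coincide with a node, so the nearest one is kept out of the
    sum.\<close>
  define p0 where "p0 = arg_min_on (\<lambda>p. norm (node \<tau> h n p - w)) S"
  have p0: "p0 \<in> S" "\<And>p. p \<in> S \<Longrightarrow> norm (node \<tau> h n p0 - w) \<le> norm (node \<tau> h n p - w)"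
    using arg_min_if_finite[OF S, of "\<lambda>p. norm (node \<tau> h n p - w)"] unfolding p0_def
    by (auto simp: not_less)
  obtain j0 k0 where p0_eq: "p0 = (j0, k0)" by (cases p0)
  have jk0: "j0 < n" "k0 < n" using p0 by (auto simp: S_def p0_eq)
  define P where "P = (\<lambda>j. nat \<bar>int j - int j0\<bar>)"
  define D where "D = (\<lambda>k. nat \<bar>int k - int k0\<bar>)"
  define a where "a = (\<lambda>j. 1 / sqrt (real (P j) + 1))"
  \<comment> \<open>Angular distance is cyclic, the smaller of \<open>D k\<close> and
    \<open>n - D k\<close>. Adding both terms dominates either case.\<close>
  define b where "b = (\<lambda>k. 1 / sqrt (real (D k) + 1) + 1 / sqrt (real (n - D k) + 1))"
  have far: "norm (node \<tau> h n p - w) > 0 \<and> 1 / norm (node \<tau> h n p - w) \<le> 4 * real n / h * (a (fst p) * b (snd p))"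
    if p: "p \<in> S - {p0}" for p
  proof -
    obtain j k where p_eq: "p = (j, k)" by (cases p)
    have jk: "j < n" "k < n" using p by (auto simp: S_def p_eq)
    define m where "m = min (D k) (n - D k)"
    define M where "M = max (P j) m"
    have M1: "M \<ge> 1"
    proof (cases "j = j0")
      case True
      then have "k \<noteq> k0" using p p_eq p0_eq by auto
      then have "1 \<le> D k" "D k < n" using jk jk0 by (auto simp: D_def)
      then show ?thesis by (simp add: M_def m_def)
    qed (auto simp: M_def P_def)
    have sep: "h * real M / real n \<le> norm (node \<tau> h n p - node \<tau> h n p0)"
      using node_separation[OF h jk(1) jk0(1) jk(2) jk0(2)]
      unfolding M_def m_def P_def D_def p_eq p0_eq max_def by auto
    also have "\<dots> \<le> norm (node \<tau> h n p - w) + norm (node \<tau> h n p0 - w)"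
      using norm_triangle_ineq4[of "node \<tau> h n p - w" "node \<tau> h n p0 - w"] by simp
    also have "\<dots> \<le> 2 * norm (node \<tau> h n p - w)" using p0(2) p by simp
    finally have lower: "h * real M / real n / 2 \<le> norm (node \<tau> h n p - w)" by simp
    have pos: "0 < h * real M / real n / 2" using h M1 n by simp
    have "1 / norm (node \<tau> h n p - w) \<le> 1 / (h * real M / real n / 2)"
      by (intro frac_le lower pos) auto
    also have "\<dots> = 2 * real n / h * (1 / real M)" using n h by simp
    also have "1 / real M \<le> 2 * (a j * b k)"
    proof -
      have "(real (P j) + 1) * (real m + 1) \<le> (2 * real M) * (2 * real M)"
        using M1 by (intro mult_mono) (auto simp: M_def)
      then have "sqrt ((real (P j) + 1) * (real m + 1)) \<le> sqrt ((2 * real M) * (2 * real M))"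
        by (rule real_sqrt_le_mono)
      then have "sqrt (real (P j) + 1) * sqrt (real m + 1) \<le> 2 * real M"
        by (simp add: real_sqrt_mult)
      then have "1 / (2 * real M) \<le> 1 / (sqrt (real (P j) + 1) * sqrt (real m + 1))"
        using M1 by (intro divide_left_mono) auto
      also have "\<dots> = a j * (1 / sqrt (real m + 1))" by (simp add: a_def)
      also have "\<dots> \<le> a j * b k"
        by (intro mult_left_mono) (auto simp: a_def b_def m_def min_def)
      finally show ?thesis by simp
    qed
    finally have "1 / norm (node \<tau> h n p - w) \<le> 2 * real n / h * (2 * (a j * b k))"
      using h by (simp add: mult_left_mono divide_right_mono)
    moreover have "0 < norm (node \<tau> h n p - w)" using lower pos by linarith
    ultimately show ?thesis by (simp add: p_eq mult_ac)
  qed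
  have sq: "(\<Sum>i\<le>n. 1 / sqrt (real i + 1)) \<le> 2 * sqrt (real n + 1)"
    using sum_inverse_sqrt_le[of "Suc n"] by (simp add: lessThan_Suc_atMost add.commute)
  have sq': "(\<Sum>i\<le>n. 1 / sqrt (real (n - i) + 1)) \<le> 2 * sqrt (real n + 1)"
    using sq by (subst (asm) sum.nat_diff_reindex[symmetric, of _ "Suc n", unfolded lessThan_Suc_atMost]) simp
  have A: "(\<Sum>j<n. a j) \<le> 4 * sqrt (real n + 1)"
    using sum_dist_le[of "\<lambda>i. 1 / sqrt (real i + 1)" j0 n] jk0 sq by (simp add: a_def P_def)
  have Bsum: "(\<Sum>k<n. b k) \<le> 8 * sqrt (real n + 1)"
    using sum_dist_le[of "\<lambda>i. 1 / sqrt (real i + 1)" k0 n]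
      sum_dist_le[of "\<lambda>i. 1 / sqrt (real (n - i) + 1)" k0 n] jk0 sq sq'
    by (simp add: b_def D_def sum.distrib)
  have ab0: "0 \<le> a j" "0 \<le> b k" for j k by (auto simp: a_def b_def)
  have "(\<Sum>p\<in>S - {p0}. 1 / norm (node \<tau> h n p - w)) \<le> (\<Sum>p\<in>S - {p0}. 4 * real n / h * (a (fst p) * b (snd p)))"
    using far by (intro sum_mono) blast
  also have "\<dots> \<le> (\<Sum>p\<in>S. 4 * real n / h * (a (fst p) * b (snd p)))"
    using h ab0 S by (intro sum_mono2) (auto intro!: mult_nonneg_nonneg)
  also have "\<dots> = 4 * real n / h * ((\<Sum>j<n. a j) * (\<Sum>k<n. b k))"
    unfolding S_def sum_product sum.cartesian_product by (simp add: sum_distrib_left case_prod_beta)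
  also have "\<dots> \<le> 4 * real n / h * ((4 * sqrt (real n + 1)) * (8 * sqrt (real n + 1)))"
    using A Bsum h ab0 by (intro mult_left_mono mult_mono) (auto intro: sum_nonneg)
  also have "\<dots> = 4 * real n / h * (32 * (real n + 1))" by simp
  also have "\<dots> \<le> 4 * real n / h * (32 * (2 * real n))"
    using h n by (intro mult_left_mono) auto
  also have "\<dots> = 256 * (real n)\<^sup>2 / h" by (simp add: power2_eq_square)
  finally have sum: "(\<Sum>p\<in>S - {p0}. 1 / norm (node \<tau> h n p - w)) \<le> 256 * (real n)\<^sup>2 / h" .
  have ne: "\<forall>p\<in>S - {p0}. node \<tau> h n p \<noteq> w" using far by force
  show "\<exists>p0\<in>{..<n} \<times> {..<n}. (\<forall>p\<in>{..<n} \<times> {..<n} - {p0}. node \<tau> h n p \<noteq> w) \<and>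
      (\<Sum>p\<in>{..<n} \<times> {..<n} - {p0}. 1 / norm (node \<tau> h n p - w)) \<le> 256 * (real n)\<^sup>2 / h"
    using p0(1) sum ne unfolding S_def by blast
qed

section \<open>Grid averages as approximate indicators of a disc\<close>

lemma norm_resolvent_le:
  fixes x :: complex
  assumes "norm x \<le> d" "d \<le> 1 / 2"
  shows "norm (x / (1 - x)) \<le> 2 * d"
proof -
  have d: "0 \<le> d" using assms norm_ge_zero order.trans by blast
  have "1 / 2 \<le> norm (1 - x)" using norm_triangle_ineq2[of 1 x] assms by simp
  then have "norm x / norm (1 - x) \<le> d / (1 / 2)" using assms d by (intro frac_le) auto
  then show ?thesis by (simp add: norm_divide)
qed

text \<open>Inside the annulus's hole, each circle contributes \<open>n / (1 - x j)\<close> with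
  \<open>x j = (w / r j) ^ n\<close> small.\<close>

lemma average_nodes_near:
  assumes h: "0 < h" "0 < \<tau>" and n: "n > 0"
    and w: "norm w \<le> \<theta> * \<tau>" "0 < \<theta>" "\<theta> < 1" "\<theta> ^ n \<le> 1 / 2"
  shows "norm ((\<Sum>p\<in>{..<n} \<times> {..<n}. node \<tau> h n p / (node \<tau> h n p - w)) / (of_nat n)\<^sup>2 - 1) \<le> 2 * \<theta> ^ n"
proof -
  define r where "r = (\<lambda>j. \<tau> + h * real j / real n)"
  define x where "x = (\<lambda>j. (w / of_real (r j)) ^ n)"
  have r: "\<tau> \<le> r j" for j using h by (simp add: r_def)
  have x: "norm (x j) \<le> \<theta> ^ n" for j
  proof -
    have "norm w \<le> \<theta> * r j" using w r[of j] by (meson less_imp_le mult_left_mono order.trans)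
    then have "norm w / r j \<le> \<theta>" using r[of j] h by (simp add: pos_divide_le_eq)
    moreover have "norm (w / of_real (r j)) = norm w / r j"
      using r[of j] h by (simp add: norm_divide del: of_real_add)
    ultimately have "norm (w / of_real (r j)) \<le> \<theta>" by simp
    then show ?thesis unfolding x_def norm_power by (intro power_mono) auto
  qed
  have row: "(\<Sum>k<n. node \<tau> h n (j, k) / (node \<tau> h n (j, k) - w)) = of_nat n * (1 + x j / (1 - x j))" for j
  proof -
    have "norm w < \<tau>" using w h by (smt (verit) mult_less_cancel_right2)
    have "0 < r j" using r[of j] h by linarith
    have "norm w \<noteq> r j" using \<open>norm w < \<tau>\<close> r[of j] by simp
    then have "(\<Sum>k<n. node \<tau> h n (j, k) / (node \<tau> h n (j, k) - w)) * (1 - x j) = of_nat n"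
      using sum_roots_of_unity_resolvent[OF n \<open>0 < r j\<close> \<open>norm w \<noteq> r j\<close>]
      by (simp only: node_def x_def r_def fst_conv snd_conv)
    moreover have "1 - x j \<noteq> 0" using x[of j] w by auto
    ultimately show ?thesis by (simp add: field_simps)
  qed
  have "(\<Sum>p\<in>{..<n} \<times> {..<n}. node \<tau> h n p / (node \<tau> h n p - w))
      = (\<Sum>j<n. of_nat n * (1 + x j / (1 - x j)))"
    unfolding row[symmetric] sum.cartesian_product by (simp add: case_prod_beta)
  also have "\<dots> = (of_nat n)\<^sup>2 + of_nat n * (\<Sum>j<n. x j / (1 - x j))"
    by (simp only: sum_distrib_left[symmetric] sum.distrib) (simp add: power2_eq_square algebra_simps)
  finally have A: "(\<Sum>p\<in>{..<n} \<times> {..<n}. node \<tau> h n p / (node \<tau> h n p - w)) / (of_nat n)\<^sup>2 - 1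
      = (\<Sum>j<n. x j / (1 - x j)) / of_nat n"
    using n by (simp add: field_simps power2_eq_square)
  have B: "norm (\<Sum>j<n. x j / (1 - x j)) \<le> (\<Sum>j<n. 2 * \<theta> ^ n)"
    by (intro sum_norm_le norm_resolvent_le x w)
  show ?thesis
    unfolding A norm_divide using B n by (simp add: pos_divide_le_eq mult.commute)
qed

text \<open>Outside the annulus the power \<open>(w / r j) ^ n\<close> is large. In terms of its
  reciprocal \<open>x j\<close>, a circle contributes \<open>- n * x j / (1 - x j)\<close>.\<close>

lemma average_nodes_far:
  assumes h: "0 < h" "0 < \<tau>" and n: "n > 0"
    and w: "\<tau> + h \<le> \<theta> * norm w" "0 < \<theta>" "\<theta> < 1" "\<theta> ^ n \<le> 1 / 2"
  shows "norm ((\<Sum>p\<in>{..<n} \<times> {..<n}. node \<tau> h n p / (node \<tau> h n p - w)) / (of_nat n)\<^sup>2) \<le> 2 * \<theta> ^ n"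
proof -
  define r where "r = (\<lambda>j. \<tau> + h * real j / real n)"
  define x where "x = (\<lambda>j. (of_real (r j) / w) ^ n)"
  have w0: "norm w > 0" using w h by (smt (verit) mult_nonneg_nonpos)
  have r: "\<tau> \<le> r j" for j using h by (simp add: r_def)
  have r2: "r j \<le> \<tau> + h" if "j < n" for j
  proof -
    have "h * real j / real n \<le> h" using h that by (simp add: pos_divide_le_eq)
    then show ?thesis by (simp add: r_def)
  qed
  have x: "norm (x j) \<le> \<theta> ^ n" if "j < n" for j
  proof -
    have "r j / norm w \<le> \<theta>" using r2[OF that] w w0 by (simp add: pos_divide_le_eq)
    moreover have "norm (of_real (r j) / w) = r j / norm w"
      using r[of j] h by (simp add: norm_divide del: of_real_add)
    ultimately have "norm (of_real (r j) / w) \<le> \<theta>" by simp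
    then show ?thesis unfolding x_def norm_power by (intro power_mono) auto
  qed
  have row: "(\<Sum>k<n. node \<tau> h n (j, k) / (node \<tau> h n (j, k) - w)) = of_nat n * (- (x j / (1 - x j)))"
    if j: "j < n" for j
  proof -
    have "\<theta> * norm w < norm w" using w w0 by simp
    have "0 < r j" using r[of j] h by linarith
    have "norm w \<noteq> r j" using \<open>\<theta> * norm w < norm w\<close> r2[OF j] w by simp
    then have A: "(\<Sum>k<n. node \<tau> h n (j, k) / (node \<tau> h n (j, k) - w)) * (1 - (w / of_real (r j)) ^ n) = of_nat n"
      using sum_roots_of_unity_resolvent[OF n \<open>0 < r j\<close> \<open>norm w \<noteq> r j\<close>]
      by (simp only: node_def r_def fst_conv snd_conv)
    have "(w / of_real (r j)) ^ n = 1 / x j" by (simp add: x_def power_divide)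
    moreover have "x j \<noteq> 0" using r[of j] h w0 by (auto simp: x_def)
    moreover have "1 - x j \<noteq> 0" using x[OF j] w by auto
    moreover have "S = N * (- (y / (1 - y)))" if "S * (1 - 1 / y) = N" "y \<noteq> 0" "1 - y \<noteq> 0" for S N y :: complex
      using that by (auto simp: field_simps)
    ultimately show ?thesis using A by metis
  qed
  have "(\<Sum>p\<in>{..<n} \<times> {..<n}. node \<tau> h n p / (node \<tau> h n p - w))
      = (\<Sum>j<n. \<Sum>k<n. node \<tau> h n (j, k) / (node \<tau> h n (j, k) - w))"
    unfolding sum.cartesian_product by (simp add: case_prod_beta)
  also have "\<dots> = of_nat n * (\<Sum>j<n. - (x j / (1 - x j)))"
    by (simp add: row sum_distrib_left)
  finally have A: "(\<Sum>p\<in>{..<n} \<times> {..<n}. node \<tau> h n p / (node \<tau> h n p - w)) / (of_nat n)\<^sup>2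
      = (\<Sum>j<n. - (x j / (1 - x j))) / of_nat n"
    using n by (simp add: field_simps power2_eq_square)
  have B: "norm (\<Sum>j<n. - (x j / (1 - x j))) \<le> (\<Sum>j<n. 2 * \<theta> ^ n)"
    unfolding sum_negf norm_minus_cancel
    by (intro sum_norm_le norm_resolvent_le x w) auto
  show ?thesis
    unfolding A norm_divide using B n by (simp add: pos_divide_le_eq mult.commute)
qed

section \<open>Pushing poles off a compact set\<close>

lemma inverse_linear_approx:
  fixes a c :: complex
  assumes "\<rho> < norm (a - c)" "e > 0"
  shows "\<exists>P. \<forall>z\<in>cball c \<rho>. norm (1 / (z - a) - poly P z) \<le> e"
proof (cases "\<rho> < 0")
  case False
  define \<delta> where "\<delta> = norm (a - c) - \<rho>"
  define \<theta> where "\<theta> = \<rho> / norm (a - c)"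
  have \<delta>: "\<delta> > 0" and \<theta>: "0 \<le> \<theta>" "\<theta> < 1" and ac: "a \<noteq> c"
  proof -
    have "norm (a - c) > 0" using assms(1) False by linarith
    then show "\<delta> > 0" "0 \<le> \<theta>" "\<theta> < 1" "a \<noteq> c"
      using assms(1) False by (auto simp: \<delta>_def \<theta>_def)
  qed
  have "0 < e * \<delta>" using assms \<delta> by simp
  then obtain m where m: "\<theta> ^ m < e * \<delta>" using real_arch_pow_inv[of "e * \<delta>" \<theta>] \<theta> by blast
  \<comment> \<open>A partial sum of the expansion of \<open>1 / (z - a)\<close> in powers of
    \<open>(z - c) / (a - c)\<close>, whose norm on the disc is at most
    \<open>\<theta> < 1\<close>.\<close>
  define P where "P = smult (- 1 / (a - c)) (\<Sum>l<m. [:- c / (a - c), 1 / (a - c):] ^ l)"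
  have "norm (1 / (z - a) - poly P z) \<le> e" if z: "z \<in> cball c \<rho>" for z
  proof -
    define x where "x = (z - c) / (a - c)"
    have zc: "norm (z - c) \<le> \<rho>" using z by (simp add: dist_norm norm_minus_commute)
    have dz: "\<delta> \<le> norm (z - a)"
      using zc norm_triangle_ineq3[of "a - c" "z - c"] by (simp add: \<delta>_def norm_minus_commute)
    then have za: "z \<noteq> a" using \<delta> by auto
    have A: "poly P z = - 1 / (a - c) * (\<Sum>l<m. x ^ l)"
    proof -
      have "poly [:- c / (a - c), 1 / (a - c):] z = x"
        by (simp add: x_def diff_divide_distrib)
      then show ?thesis by (simp add: P_def poly_sum)
    qed
    have "1 - x = (a - z) / (a - c)" using ac by (simp add: x_def field_simps)
    then have B: "- 1 / (a - c) = (1 - x) * (1 / (z - a))"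
      using ac za by (simp add: field_simps)
    have "poly P z = (1 - x) * (\<Sum>l<m. x ^ l) * (1 / (z - a))"
      unfolding A B by (simp only: mult_ac)
    also have "\<dots> = (1 - x ^ m) * (1 / (z - a))" by (simp only: one_diff_power_eq)
    finally have "1 / (z - a) - poly P z = x ^ m / (z - a)"
      by (simp add: diff_divide_distrib)
    then have "norm (1 / (z - a) - poly P z) = norm x ^ m / norm (z - a)"
      by (simp only: norm_divide norm_power)
    also have "\<dots> \<le> \<theta> ^ m / \<delta>"
    proof (intro frac_le \<delta> dz power_mono)
      show "norm x \<le> \<theta>" using zc by (simp add: x_def \<theta>_def norm_divide divide_right_mono)
    qed (use \<theta> in auto)
    also have "\<dots> \<le> e" using m \<delta> by (simp add: pos_divide_le_eq)
    finally show ?thesis .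
  qed
  then show ?thesis by blast
qed auto

text \<open>The zeros of \<open>q\<close> on \<open>X\<close> lie outside the disc, where
  \<open>1 / (z - a)\<close> can be replaced by a polynomial. The induction on the degree treats one
  such zero at a time.\<close>

lemma rational_push_poles:
  assumes X: "compact X" and q: "\<And>z. z \<in> X \<inter> cball c \<rho> \<Longrightarrow> poly q z \<noteq> 0" and q0: "q \<noteq> 0"
    and e: "e > 0"
  shows "\<exists>r\<in>rational_without_poles_on X. \<forall>z\<in>X \<inter> cball c \<rho>. norm (poly p z / poly q z - r z) \<le> e"
  using q q0 e
proof (induction "degree q" arbitrary: q e rule: less_induct)
  case less
  show ?case
  proof (cases "\<forall>z\<in>X. poly q z \<noteq> 0")
    case True
    then have "(\<lambda>z. poly p z / poly q z) \<in> rational_without_poles_on X"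
      unfolding rational_without_poles_on_def by blast
    then show ?thesis using less.prems(3) by (intro bexI[of _ "\<lambda>z. poly p z / poly q z"]) auto
  next
    case False
    then obtain a where a: "a \<in> X" "poly q a = 0" by blast
    then have ac: "\<rho> < norm (a - c)"
      using less.prems(1)[of a] by (force simp: dist_norm norm_minus_commute)
    obtain q2 where q2: "q = [:- a, 1:] * q2" using a(2) poly_eq_0_iff_dvd by (metis dvdE)
    have q20: "q2 \<noteq> 0" using less.prems(2) q2 by auto
    have deg: "degree q2 < degree q" using q20 unfolding q2 by (subst degree_mult_eq) auto
    define \<delta> where "\<delta> = norm (a - c) - \<rho>"
    have \<delta>: "\<delta> > 0" using ac by (simp add: \<delta>_def)
    \<comment> \<open>The factor \<open>1 / (z - a)\<close> magnifies the error for
      \<open>q2\<close> by at most \<open>1 / \<delta>\<close>; the other half of \<open>e\<close>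
      is left for the polynomial.\<close>
    have "e * \<delta> / 2 > 0" using \<delta> less.prems(3) by simp
    moreover have "poly q2 z \<noteq> 0" if "z \<in> X \<inter> cball c \<rho>" for z
      using less.prems(1)[OF that] by (auto simp: q2)
    ultimately obtain r where r: "r \<in> rational_without_poles_on X"
      "\<forall>z\<in>X \<inter> cball c \<rho>. norm (poly p z / poly q2 z - r z) \<le> e * \<delta> / 2"
      using less.hyps[OF deg _ q20] by blast
    obtain N where N: "N > 0" "\<And>z. z \<in> X \<Longrightarrow> norm (r z) \<le> N"
      using R_bounded[OF X rational_in_R[OF r(1)]] by blast
    have "e / (2 * N) > 0" using N less.prems(3) by simp
    then obtain P where P: "\<forall>z\<in>cball c \<rho>. norm (1 / (z - a) - poly P z) \<le> e / (2 * N)"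
      using inverse_linear_approx[OF ac] by blast
    have "norm (poly p z / poly q z - r z * poly P z) \<le> e" if z: "z \<in> X \<inter> cball c \<rho>" for z
    proof -
      have "norm (z - c) \<le> \<rho>" using z by (simp add: dist_norm norm_minus_commute)
      then have dz: "\<delta> \<le> norm (z - a)"
        using norm_triangle_ineq3[of "a - c" "z - c"] by (simp add: \<delta>_def norm_minus_commute)
      have "poly q z = poly q2 z * (z - a)" by (simp add: q2 algebra_simps)
      then have "poly p z / poly q z = poly p z / poly q2 z * (1 / (z - a))" by simp
      then have "poly p z / poly q z - r z * poly P z
          = (poly p z / poly q2 z - r z) * (1 / (z - a)) + r z * (1 / (z - a) - poly P z)"
        by (simp add: algebra_simps)
      then have "norm (poly p z / poly q z - r z * poly P z)
          \<le> norm (poly p z / poly q2 z - r z) * norm (1 / (z - a)) + norm (r z) * norm (1 / (z - a) - poly P z)"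
        by (metis norm_mult norm_triangle_ineq)
      also have "norm (1 / (z - a)) \<le> 1 / \<delta>"
        using dz \<delta> by (simp add: norm_divide frac_le)
      then have "norm (poly p z / poly q2 z - r z) * norm (1 / (z - a)) + norm (r z) * norm (1 / (z - a) - poly P z)
        \<le> e * \<delta> / 2 * (1 / \<delta>) + N * (e / (2 * N))"
        using r(2) N P z \<delta> less.prems(3) by (intro add_mono mult_mono) auto
      also have "\<dots> = e" using \<delta> N by simp
      finally show ?thesis .
    qed
    then show ?thesis
      using rational_mult[OF r(1) rational_poly[of P X]]
      by (intro bexI[of _ "\<lambda>z. r z * poly P z"]) auto
  qed
qed

text \<open>
  It matters that \<open>C\<close> depends neither on \<open>r\<close> nor on \<open>X\<close>. Away from the annulus the average is
  close to \<open>0\<close> or \<open>1\<close>; inside it, only the nearest node has a contribution that depends on \<open>r\<close>, and a fine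
  grid makes this single term negligible.
\<close>

lemma cutoff_constant:
  assumes \<sigma>: "0 < \<sigma>" "\<sigma> < \<rho>"
  shows "\<exists>C>0. \<forall>X r \<epsilon>. compact X \<and> r \<in> rational_without_poles_on X \<and> \<epsilon> > 0 \<and>
      (\<forall>z\<in>X. \<sigma> \<le> norm (z - c) \<and> norm (z - c) \<le> \<rho> \<longrightarrow> norm (r z) < \<epsilon>) \<longrightarrow>
      (\<exists>F\<in>R X. \<forall>z\<in>X. norm (F z - (if norm (z - c) < \<sigma> then r z else 0)) \<le> C * \<epsilon>)"
proof -
  \<comment> \<open>The nodes will have radii between \<open>\<sigma> + h\<close> and
    \<open>\<sigma> + 2 * h\<close>, at distance at least \<open>h\<close> from both boundary
    circles. The bound \<open>h \<le> \<sigma>\<close> gives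
    \<open>2 * h \<le> \<tau>\<close>.\<close>
  define h where "h = min \<sigma> ((\<rho> - \<sigma>) / 3)"
  define \<tau> where "\<tau> = \<sigma> + h"
  have h: "0 < h" "2 * h \<le> \<tau>" "\<tau> + h + h \<le> \<rho>" using \<sigma> by (auto simp: h_def \<tau>_def min_def field_simps)
  have \<tau>: "0 < \<tau>" using h \<sigma> by (simp add: \<tau>_def)
  define \<theta> where "\<theta> = max (\<sigma> / \<tau>) ((\<tau> + h) / \<rho>)"
  have "\<sigma> / \<tau> < 1" "(\<tau> + h) / \<rho> < 1" "0 < \<sigma> / \<tau>" using \<sigma> h \<tau> by (auto simp: \<tau>_def)
  then have \<theta>: "0 < \<theta>" "\<theta> < 1" by (auto simp: \<theta>_def)
  have \<theta>1: "\<sigma> \<le> \<theta> * \<tau>" and \<theta>2: "\<tau> + h \<le> \<theta> * \<rho>"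
  proof -
    have "\<sigma> / \<tau> \<le> \<theta>" "(\<tau> + h) / \<rho> \<le> \<theta>" by (auto simp: \<theta>_def)
    then show "\<sigma> \<le> \<theta> * \<tau>" "\<tau> + h \<le> \<theta> * \<rho>" using \<tau> \<sigma> by (auto simp: pos_divide_le_eq)
  qed
  \<comment> \<open>Dominates \<open>1 + 2 * 256 * \<rho> / h\<close>, needed on the annulus, and
    \<open>1 + \<rho> / h\<close>, needed off it.\<close>
  define C where "C = 1 + 1 + 512 * \<rho> / h"
  have C: "C > 0" using h \<sigma> by (auto simp: C_def intro!: add_pos_nonneg)
  have "\<exists>F\<in>R X. \<forall>z\<in>X. norm (F z - (if norm (z - c) < \<sigma> then r z else 0)) \<le> C * \<epsilon>"
    if X: "compact X" and r: "r \<in> rational_without_poles_on X" and \<epsilon>: "\<epsilon> > 0"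
      and small: "\<And>z. z \<in> X \<Longrightarrow> \<sigma> \<le> norm (z - c) \<Longrightarrow> norm (z - c) \<le> \<rho> \<Longrightarrow> norm (r z) < \<epsilon>"
    for X r \<epsilon>
  proof -
    obtain p q where pq: "r = (\<lambda>z. poly p z / poly q z)" "\<forall>z\<in>X. poly q z \<noteq> 0"
      using r unfolding rational_without_poles_on_def by blast
    obtain N where N: "N > 0" "\<And>z. z \<in> X \<Longrightarrow> norm (r z) \<le> N"
      using R_bounded[OF X rational_in_R[OF r]] by blast
    have "(\<lambda>z. 1 / poly q z) \<in> R X" using pq(2) by (intro R_inverse[OF X] rational_in_R rational_poly) auto
    then obtain K where K: "K > 0" "\<And>z. z \<in> X \<Longrightarrow> norm (1 / poly q z) \<le> K"
      by (rule R_bounded[OF X]) (rule that)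
    define \<kappa> where "\<kappa> = 1 / (2 * K)"
    have \<kappa>: "\<kappa> > 0" using K by (simp add: \<kappa>_def)
    have q\<kappa>: "\<kappa> < norm (poly q z)" if "z \<in> X" for z
      using K(1) K(2)[OF that] pq(2) that by (simp add: \<kappa>_def norm_divide field_simps)
    obtain L where L: "L > 0" "\<forall>a. norm a \<le> norm c + \<rho> \<and> \<kappa> \<le> norm (poly q a) \<longrightarrow>
      (\<exists>s\<in>rational_without_poles_on X.
        \<forall>z\<in>X. (z - a) * s z = poly p z / poly q z - poly p a / poly q a \<and> norm (s z) \<le> L)"
      using rational_diff_quotient[OF X _ \<kappa>, of q "norm c + \<rho>" p] pq(2) by blast
    \<comment> \<open>A neighbourhood of \<open>A\<close>, the part of \<open>X\<close> in the
      annulus, on which \<open>r\<close> stays small and its denominator bounded below. With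
      denominators cleared, openness is continuity of polynomials.\<close>
    define W where "W = {a. \<kappa> < norm (poly q a) \<and> norm (poly p a) < \<epsilon> * norm (poly q a)}"
    have Wr: "norm (r a) < \<epsilon>" if "a \<in> W" for a
    proof -
      have "norm (poly q a) > 0" using that \<kappa> unfolding W_def by auto
      then show ?thesis using that by (simp add: W_def pq norm_divide pos_divide_less_eq)
    qed
    have "open W" unfolding W_def
      by (intro open_Collect_conj open_Collect_less continuous_intros)
    define A where "A = X \<inter> {z. \<sigma> \<le> norm (z - c) \<and> norm (z - c) \<le> \<rho>}"
    have "closed {z. \<sigma> \<le> norm (z - c) \<and> norm (z - c) \<le> \<rho>}"
      by (intro closed_Collect_conj closed_Collect_le continuous_intros)
    then have "compact A" unfolding A_def using X by (rule compact_Int_closed[rotated])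
    have AW: "A \<subseteq> W"
    proof
      fix z assume z: "z \<in> A"
      then have "norm (r z) < \<epsilon>" "\<kappa> < norm (poly q z)" using small q\<kappa> by (auto simp: A_def)
      moreover from this have "norm (poly q z) > 0" using \<kappa> by linarith
      ultimately show "z \<in> W" by (simp add: W_def pq norm_divide pos_divide_less_eq)
    qed
    have "A \<inter> - W = {}" using AW by blast
    then obtain \<delta> where "\<delta> > 0" "\<And>z a. z \<in> A \<Longrightarrow> a \<in> - W \<Longrightarrow> \<delta> \<le> dist z a"
      using separate_compact_closed[OF \<open>compact A\<close>, of "- W"] \<open>open W\<close>
      by (meson closed_Compl)
    then have \<delta>: "\<delta> > 0" "\<And>z a. z \<in> A \<Longrightarrow> a \<notin> W \<Longrightarrow> \<delta> \<le> norm (z - a)"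
      by (auto simp: dist_norm)
    \<comment> \<open>Bounds \<open>T\<close> at the nearest node, inside or outside
      \<open>W\<close>. It depends on \<open>r\<close>, but this one term is divided by
      \<open>n\<^sup>2\<close> and \<open>n\<close> is chosen afterwards.\<close>
    define Mx where "Mx = max L (\<epsilon> / \<delta>)"
    have "\<forall>\<^sub>F n in sequentially. n > 0 \<and> \<rho> * Mx / \<epsilon> \<le> real n \<and> \<theta> ^ n < 1 / 2 \<and> \<theta> ^ n < \<epsilon> / (2 * N)"
    proof (intro eventually_conj)
      have "(\<lambda>n. \<theta> ^ n) \<longlonglongrightarrow> 0" using \<theta> by (intro LIMSEQ_realpow_zero) auto
      then show "\<forall>\<^sub>F n in sequentially. \<theta> ^ n < 1 / 2" "\<forall>\<^sub>F n in sequentially. \<theta> ^ n < \<epsilon> / (2 * N)"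
        using \<epsilon> N by (auto intro!: order_tendstoD(2) simp del: less_divide_eq_numeral1 pos_less_divide_eq)
      show "\<forall>\<^sub>F n in sequentially. \<rho> * Mx / \<epsilon> \<le> real n"
        using filterlim_real_sequentially by (simp add: filterlim_at_top)
    qed (rule eventually_gt_at_top)
    then obtain n where n: "n > 0" "\<rho> * Mx / \<epsilon> \<le> real n" "\<theta> ^ n \<le> 1 / 2" "\<theta> ^ n < \<epsilon> / (2 * N)"
      by (metis (no_types, lifting) eventually_happens less_imp_le sequentially_bot)
    define S where "S = {..<n} \<times> {..<n}"
    define t where "t = node \<tau> h n"
    have S: "finite S" by (simp add: S_def)
    have t: "\<tau> \<le> norm (t a)" "norm (t a) \<le> \<tau> + h" "norm (t a) \<le> \<rho>" if "a \<in> S" for a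
      using norm_node(2,3)[of \<tau> h a n] that \<tau> h by (auto simp: t_def S_def)
    have tW: "c + t a \<notin> X" if "a \<in> S" "c + t a \<notin> W" for a
      using t[OF that(1)] that AW h by (auto simp: A_def \<tau>_def)
    \<comment> \<open>A node in \<open>W\<close> may lie on \<open>X\<close>, so its pole is
      cancelled by subtracting the value of \<open>r\<close> there, which is smaller than
      \<open>\<epsilon>\<close>. A node outside \<open>W\<close> is off \<open>X\<close> and its
      pole does no harm.\<close>
    have "\<forall>a. \<exists>T. a \<in> S \<longrightarrow> T \<in> R X \<and>
        (\<forall>z\<in>X. z \<noteq> c + t a \<longrightarrow> T z = (r z - (if c + t a \<in> W then r (c + t a) else 0)) / (c + t a - z)) \<and>
        (\<forall>z\<in>A. c + t a \<in> W \<longrightarrow> norm (T z) \<le> L)"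
    proof
      fix a
      show "\<exists>T. a \<in> S \<longrightarrow> T \<in> R X \<and>
        (\<forall>z\<in>X. z \<noteq> c + t a \<longrightarrow> T z = (r z - (if c + t a \<in> W then r (c + t a) else 0)) / (c + t a - z)) \<and>
        (\<forall>z\<in>A. c + t a \<in> W \<longrightarrow> norm (T z) \<le> L)"
      proof (cases "a \<in> S \<and> c + t a \<in> W")
        case True
        then have "norm (c + t a) \<le> norm c + \<rho>" "\<kappa> \<le> norm (poly q (c + t a))"
          using t(3)[of a] norm_triangle_ineq[of c "t a"] by (auto simp: W_def)
        then obtain s where s: "s \<in> rational_without_poles_on X"
          "\<And>z. z \<in> X \<Longrightarrow> (z - (c + t a)) * s z = r z - r (c + t a) \<and> norm (s z) \<le> L"
          using L(2) unfolding pq by blast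
        have sR: "(\<lambda>z. - 1 * s z) \<in> R X" by (intro R_mult X R_const rational_in_R s)
        have "- 1 * s z = (r z - r (c + t a)) / (c + t a - z)" if "z \<in> X" "z \<noteq> c + t a" for z
        proof -
          have "r z - r (c + t a) = (z - (c + t a)) * s z" using s(2)[OF that(1)] by simp
          also have "\<dots> = (c + t a - z) * (- 1 * s z)" by (simp add: algebra_simps)
          finally show ?thesis using that by simp
        qed
        moreover have "norm (- 1 * s z) \<le> L" if "z \<in> A" for z
          using s(2)[of z] that by (simp add: A_def)
        ultimately show ?thesis using sR True by (intro exI[of _ "\<lambda>z. - 1 * s z"]) auto
      next
        case False
        show ?thesis
        proof (cases "a \<in> S")
          case aS: True
          then have "c + t a \<notin> X" using tW False by blast
          then have "(\<lambda>z. r z * (1 / (c + t a - z))) \<in> R X"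
            by (intro R_mult X rational_in_R r rational_inverse_linear)
          then show ?thesis using False aS by (intro exI[of _ "\<lambda>z. r z * (1 / (c + t a - z))"]) auto
        qed auto
      qed
    qed
    then obtain T where T: "\<And>a. a \<in> S \<Longrightarrow> T a \<in> R X"
      "\<And>a z. a \<in> S \<Longrightarrow> z \<in> X \<Longrightarrow> z \<noteq> c + t a \<Longrightarrow>
        T a z = (r z - (if c + t a \<in> W then r (c + t a) else 0)) / (c + t a - z)"
      "\<And>a z. a \<in> S \<Longrightarrow> z \<in> A \<Longrightarrow> c + t a \<in> W \<Longrightarrow> norm (T a z) \<le> L"
      by metis
    define F where "F = (\<lambda>z. (\<Sum>a\<in>S. t a * T a z) / (of_nat n)\<^sup>2)"
    have F: "F \<in> R X" unfolding F_def
      by (intro R_divide_const X R_sum S R_mult R_const T)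
    have FA: "norm (F z) \<le> C * \<epsilon>" if z: "z \<in> A" for z
    proof -
      have zX: "z \<in> X" and rz: "norm (r z) < \<epsilon>" using z AW Wr by (auto simp: A_def)
      obtain a0 where a0: "a0 \<in> S" "\<And>a. a \<in> S - {a0} \<Longrightarrow> t a \<noteq> z - c"
        "(\<Sum>a\<in>S - {a0}. 1 / norm (t a - (z - c))) \<le> 256 * (real n)\<^sup>2 / h"
        using node_kernel_sum[OF h(1,2) n(1), of "z - c"] unfolding S_def t_def by blast
      have near: "norm (T a0 z) \<le> Mx"
      proof (cases "c + t a0 \<in> W")
        case True
        then show ?thesis using T(3)[OF a0(1) z] by (simp add: Mx_def)
      next
        case False
        have d: "\<delta> \<le> norm (z - (c + t a0))" by (rule \<delta>(2)[OF z False])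
        then have "z \<noteq> c + t a0" using \<delta>(1) by auto
        then have "norm (T a0 z) = norm (r z) / norm (z - (c + t a0))"
          using T(2)[OF a0(1) zX] False by (simp add: norm_divide norm_minus_commute)
        also have "\<dots> \<le> \<epsilon> / \<delta>" using d \<delta>(1) rz \<epsilon> by (intro frac_le) auto
        finally show ?thesis by (simp add: Mx_def)
      qed
      \<comment> \<open>The numerator is at most \<open>2 * \<epsilon>\<close> merely because
        \<open>r\<close> is small at both points. No modulus of continuity of \<open>r\<close>
        enters, so the kernel sum gives a constant independent of \<open>r\<close>.\<close>
      have far: "norm (t a * T a z) \<le> \<rho> * (2 * \<epsilon>) * (1 / norm (t a - (z - c)))" if a: "a \<in> S - {a0}" for a
      proof -
        have "z \<noteq> c + t a" using a0(2)[OF a] by auto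
        then have "T a z = (r z - (if c + t a \<in> W then r (c + t a) else 0)) / (t a - (z - c))"
          using T(2)[of a z] a zX by (simp add: algebra_simps)
        moreover have "norm (r z - (if c + t a \<in> W then r (c + t a) else 0)) \<le> 2 * \<epsilon>"
          using norm_triangle_ineq4[of "r z" "if c + t a \<in> W then r (c + t a) else 0"] rz Wr[of "c + t a"] \<epsilon>
          by (auto split: if_splits)
        ultimately have "norm (T a z) \<le> 2 * \<epsilon> * (1 / norm (t a - (z - c)))"
          by (simp add: norm_divide divide_right_mono)
        then have "norm (t a) * norm (T a z) \<le> \<rho> * (2 * \<epsilon> * (1 / norm (t a - (z - c))))"
          using t(3)[of a] a \<sigma> by (intro mult_mono) auto
        then show ?thesis by (simp add: norm_mult mult.assoc)
      qed
      have "norm (\<Sum>a\<in>S. t a * T a z) \<le> norm (t a0 * T a0 z) + norm (\<Sum>a\<in>S - {a0}. t a * T a z)"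
        using sum.remove[OF S a0(1), of "\<lambda>a. t a * T a z"] norm_triangle_ineq by simp
      also have "norm (t a0 * T a0 z) \<le> \<rho> * Mx"
        unfolding norm_mult using t(3)[OF a0(1)] near \<sigma> by (intro mult_mono) auto
      also have "norm (\<Sum>a\<in>S - {a0}. t a * T a z) \<le> (\<Sum>a\<in>S - {a0}. \<rho> * (2 * \<epsilon>) * (1 / norm (t a - (z - c))))"
        by (intro sum_norm_le far)
      also have "\<dots> \<le> \<rho> * (2 * \<epsilon>) * (256 * (real n)\<^sup>2 / h)"
        unfolding sum_distrib_left[symmetric] using a0(3) \<sigma> \<epsilon> by (intro mult_left_mono) auto
      also have "\<rho> * Mx \<le> \<epsilon> * (real n)\<^sup>2"
      proof -
        have "\<rho> * Mx \<le> \<epsilon> * real n" using n(2) \<epsilon> by (simp add: pos_divide_le_eq mult.commute)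
        also have "\<dots> \<le> \<epsilon> * (real n)\<^sup>2" using \<epsilon> n(1) by (intro mult_left_mono) (auto simp: power2_eq_square)
        finally show ?thesis .
      qed
      finally have "norm (\<Sum>a\<in>S. t a * T a z) \<le> (\<epsilon> + 512 * \<rho> / h * \<epsilon>) * (real n)\<^sup>2"
        by (simp add: algebra_simps)
      then have "norm (F z) \<le> \<epsilon> + 512 * \<rho> / h * \<epsilon>"
        using n(1) by (simp add: F_def norm_divide norm_power pos_divide_le_eq)
      also have "\<dots> \<le> C * \<epsilon>" using \<epsilon> by (simp add: C_def algebra_simps)
      finally show ?thesis .
    qed
    have Fout: "norm (F z - (if norm (z - c) < \<sigma> then r z else 0)) \<le> C * \<epsilon>" if zX: "z \<in> X" and z: "z \<notin> A" for z
    proof -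
      have d: "h \<le> norm (t a - (z - c))" if "a \<in> S" for a
      proof -
        have "norm (z - c) < \<sigma> \<or> \<rho> < norm (z - c)" using z zX by (auto simp: A_def)
        then show ?thesis
          using t(1,2)[OF that] h norm_triangle_ineq3[of "t a" "z - c"] by (auto simp: \<tau>_def)
      qed
      \<comment> \<open>Off the annulus the nodes are at distance at least \<open>h\<close>, so the
        two parts of \<open>T\<close> can be averaged separately: \<open>\<phi>\<close> approximates
        the indicator of the disc, and the subtracted values contribute at most
        \<open>\<rho> * \<epsilon> / h\<close>.\<close>
      define \<phi> where "\<phi> = (\<Sum>a\<in>S. t a / (t a - (z - c))) / (of_nat n)\<^sup>2"
      define G where "G = (\<lambda>a. t a * (if c + t a \<in> W then r (c + t a) else 0) / (t a - (z - c)))"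
      have "t a * T a z = r z * (t a / (t a - (z - c))) - G a" if a: "a \<in> S" for a
      proof -
        have "z \<noteq> c + t a" using d[OF a] h by auto
        then have *: "T a z = (r z - (if c + t a \<in> W then r (c + t a) else 0)) / (t a - (z - c))"
          using T(2)[OF a zX] by (simp add: algebra_simps)
        have "x * ((y - v) / d) = y * (x / d) - x * v / d" for x y v d :: complex
          by (simp add: algebra_simps diff_divide_distrib)
        then show ?thesis unfolding * G_def by this
      qed
      then have "(\<Sum>a\<in>S. t a * T a z) = r z * (\<Sum>a\<in>S. t a / (t a - (z - c))) - (\<Sum>a\<in>S. G a)"
        by (simp add: sum_subtractf sum_distrib_left)
      then have Fz: "F z = r z * \<phi> - (\<Sum>a\<in>S. G a) / (of_nat n)\<^sup>2"
        by (simp add: F_def \<phi>_def diff_divide_distrib)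
      have "norm (G a) \<le> \<rho> * \<epsilon> / h" if a: "a \<in> S" for a
      proof -
        have "norm (if c + t a \<in> W then r (c + t a) else 0) \<le> \<epsilon>" using Wr \<epsilon> by (auto intro: less_imp_le)
        then have "norm (t a) * norm (if c + t a \<in> W then r (c + t a) else 0) \<le> \<rho> * \<epsilon>"
          using t(3)[OF a] \<sigma> by (intro mult_mono) auto
        then show ?thesis unfolding G_def norm_divide norm_mult
          using d[OF a] h \<sigma> \<epsilon> by (intro frac_le) auto
      qed
      then have "norm (\<Sum>a\<in>S. G a) \<le> (\<Sum>a\<in>S. \<rho> * \<epsilon> / h)" by (rule sum_norm_le)
      also have "\<dots> = \<rho> * \<epsilon> / h * (real n)\<^sup>2" by (simp add: S_def power2_eq_square)
      finally have "norm (\<Sum>a\<in>S. G a) / (real n)\<^sup>2 \<le> \<rho> * \<epsilon> / h"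
        using n(1) by (simp add: pos_divide_le_eq)
      then have E: "norm ((\<Sum>a\<in>S. G a) / (of_nat n)\<^sup>2) \<le> \<rho> * \<epsilon> / h"
        by (simp only: norm_divide norm_power norm_of_nat)
      define v :: complex where "v = (if norm (z - c) < \<sigma> then 1 else 0)"
      have \<phi>: "norm (\<phi> - v) \<le> 2 * \<theta> ^ n"
      proof (cases "norm (z - c) < \<sigma>")
        case True
        then have "norm (z - c) \<le> \<theta> * \<tau>" using \<theta>1 by simp
        then show ?thesis
          using average_nodes_near[OF h(1) \<tau> n(1) _ \<theta> n(3)] True by (simp add: v_def \<phi>_def S_def t_def)
      next
        case False
        then have "\<rho> < norm (z - c)" using z zX by (auto simp: A_def)
        then have "\<theta> * \<rho> \<le> \<theta> * norm (z - c)" using \<theta> by simp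
        then have "\<tau> + h \<le> \<theta> * norm (z - c)" using \<theta>2 by simp
        then show ?thesis
          using average_nodes_far[OF h(1) \<tau> n(1) _ \<theta> n(3)] False by (simp add: v_def \<phi>_def S_def t_def)
      qed
      have "F z - (if norm (z - c) < \<sigma> then r z else 0) = r z * (\<phi> - v) - (\<Sum>a\<in>S. G a) / (of_nat n)\<^sup>2"
        unfolding Fz by (simp add: v_def algebra_simps)
      then have "norm (F z - (if norm (z - c) < \<sigma> then r z else 0)) \<le> norm (r z * (\<phi> - v)) + norm ((\<Sum>a\<in>S. G a) / (of_nat n)\<^sup>2)"
        by (metis norm_triangle_ineq4)
      also have "norm (r z * (\<phi> - v)) \<le> N * (2 * \<theta> ^ n)"
        unfolding norm_mult using N(1) N(2)[OF zX] \<phi> by (intro mult_mono) auto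
      also have "\<dots> \<le> \<epsilon>" using n(4) N(1) by (simp add: field_simps)
      also note E
      also have "\<epsilon> + \<rho> * \<epsilon> / h \<le> C * \<epsilon>" using \<epsilon> \<sigma> h by (simp add: C_def field_simps)
      finally show ?thesis by simp
    qed
    have "norm (F z - (if norm (z - c) < \<sigma> then r z else 0)) \<le> C * \<epsilon>" if "z \<in> X" for z
      using FA[of z] Fout[OF that] by (cases "z \<in> A") (auto simp: A_def)
    with F show ?thesis by blast
  qed
  with C show ?thesis by blast
qed

text \<open>Approximate \<open>b\<close> rationally on \<open>Y\<close>, push the poles off
  \<open>X\<close>, and apply \<open>cutoff_constant\<close>. Since \<open>b\<close> vanishes on the
  annulus, the approximant is small there, and the fixed \<open>C\<close> makes the error tend to
  0.\<close>

lemma R_cutoff: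
  assumes X: "compact X" and XY: "X \<inter> cball c \<rho> \<subseteq> Y" and b: "b \<in> R Y"
    and \<sigma>: "0 < \<sigma>" "\<sigma> < \<rho>"
    and b0: "\<And>z. z \<in> X \<Longrightarrow> \<sigma> \<le> dist c z \<Longrightarrow> dist c z \<le> \<rho> \<Longrightarrow> b z = 0"
  shows "(\<lambda>z. if dist c z \<le> \<rho> then b z else 0) \<in> R X"
\<comment> \<open>In the nonempty case \<open>Y\<close> contains a point, so the denominator
  \<open>q\<close> below is not the zero polynomial.\<close>
proof (cases "X \<inter> cball c \<rho> = {}")
  case True
  then have "\<And>z. z \<in> X \<Longrightarrow> \<not> dist c z \<le> \<rho>" by force
  then show ?thesis by (intro R_cong[OF R_const[of 0]]) auto
next
  case nonempty: False
  obtain C where C: "C > 0" and C2: "\<forall>X r \<epsilon>. compact X \<and> r \<in> rational_without_poles_on X \<and> \<epsilon> > 0 \<and>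
      (\<forall>z\<in>X. \<sigma> \<le> norm (z - c) \<and> norm (z - c) \<le> \<rho> \<longrightarrow> norm (r z) < \<epsilon>) \<longrightarrow>
      (\<exists>F\<in>R X. \<forall>z\<in>X. norm (F z - (if norm (z - c) < \<sigma> then r z else 0)) \<le> C * \<epsilon>)"
    using cutoff_constant[OF \<sigma>, of c] by (elim exE conjE) (rule that)
  show ?thesis
  proof (rule R_limit)
    fix e :: real assume e: "e > 0"
    define \<epsilon> where "\<epsilon> = e / (C + 1)"
    have \<epsilon>: "\<epsilon> > 0" "\<epsilon> / 2 > 0" using e C by (auto simp: \<epsilon>_def)
    obtain r0 where r0: "r0 \<in> rational_without_poles_on Y" "\<And>z. z \<in> Y \<Longrightarrow> norm (b z - r0 z) < \<epsilon> / 2"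
      using R_approx[OF b \<epsilon>(2)] by blast
    obtain p q where pq: "r0 = (\<lambda>z. poly p z / poly q z)" "\<forall>z\<in>Y. poly q z \<noteq> 0"
      using r0(1) unfolding rational_without_poles_on_def by blast
    have "\<exists>r\<in>rational_without_poles_on X. \<forall>z\<in>X \<inter> cball c \<rho>. norm (poly p z / poly q z - r z) \<le> \<epsilon> / 2"
      using XY pq(2) nonempty by (intro rational_push_poles[OF X _ _ \<epsilon>(2)]) auto
    then obtain r where r: "r \<in> rational_without_poles_on X"
      "\<And>z. z \<in> X \<inter> cball c \<rho> \<Longrightarrow> norm (r0 z - r z) \<le> \<epsilon> / 2" unfolding pq by blast
    have br: "norm (b z - r z) < \<epsilon>" if "z \<in> X \<inter> cball c \<rho>" for z
    proof -
      have "z \<in> Y" using that XY by blast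
      then show ?thesis
        using r(2)[OF that] r0(2)[of z] norm_triangle_ineq[of "b z - r0 z" "r0 z - r z"] by simp
    qed
    have "\<forall>z\<in>X. \<sigma> \<le> norm (z - c) \<and> norm (z - c) \<le> \<rho> \<longrightarrow> norm (r z) < \<epsilon>"
      using br b0 by (force simp: dist_norm norm_minus_commute)
    then obtain F where F: "F \<in> R X" "\<And>z. z \<in> X \<Longrightarrow> norm (F z - (if norm (z - c) < \<sigma> then r z else 0)) \<le> C * \<epsilon>"
      using C2[THEN spec, THEN spec, THEN spec, of X r \<epsilon>] X r(1) \<epsilon>(1) by blast
    have "norm ((if dist c z \<le> \<rho> then b z else 0) - F z) \<le> e" if z: "z \<in> X" for z
    proof -
      have "norm ((if dist c z \<le> \<rho> then b z else 0) - (if norm (z - c) < \<sigma> then r z else 0)) \<le> \<epsilon>"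
      proof (cases "norm (z - c) < \<sigma>")
        case True
        then have "z \<in> X \<inter> cball c \<rho>" using \<sigma> z by (simp add: dist_norm norm_minus_commute)
        then show ?thesis using br[of z] True by auto
      next
        case False
        then show ?thesis using b0[OF z] \<epsilon> by (auto simp: dist_norm norm_minus_commute)
      qed
      then have "norm ((if dist c z \<le> \<rho> then b z else 0) - F z) \<le> \<epsilon> + C * \<epsilon>"
        using F(2)[OF z] norm_triangle_ineq4[of
          "(if dist c z \<le> \<rho> then b z else 0) - (if norm (z - c) < \<sigma> then r z else 0)"
          "F z - (if norm (z - c) < \<sigma> then r z else 0)"] by simp
      also have "\<dots> = (C + 1) * \<epsilon>" by (simp add: algebra_simps)
      also have "\<dots> = e" using C by (simp add: \<epsilon>_def)
      finally show ?thesis .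
    qed
    with F show "\<exists>g\<in>R X. \<forall>z\<in>X. norm ((if dist c z \<le> \<rho> then b z else 0) - g z) \<le> e" by blast
  qed
qed

section \<open>The theorem\<close>

theorem theorem7p5:
  fixes X E :: "complex set" and I :: "'i set" and Y :: "'i \<Rightarrow> complex set"
  assumes "compact_plane_set X"
    and "E \<subseteq> X" and "countable E"
    and "\<And>\<alpha>. \<alpha> \<in> I \<Longrightarrow> compact_plane_set (Y \<alpha>)"
    and "\<And>\<alpha>. \<alpha> \<in> I \<Longrightarrow> regular_on (Y \<alpha>) (R (Y \<alpha>))"
    and "X - E \<subseteq> (\<Union>\<alpha>\<in>I. top_of_set X interior_of (X \<inter> Y \<alpha>))"
  shows "regular_on X (R X)"
  unfolding regular_on_def
proof (intro allI impI)
  fix A x0 assume A: "closed A \<and> A \<subseteq> X \<and> x0 \<in> X - A"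
  have X: "compact X" using assms(1) by (simp add: compact_plane_set_def)
  have "open (- A)" "x0 \<in> - A" using A by auto
  then obtain s where s: "s > 0" "ball x0 s \<subseteq> - A" using openE by blast
  have "countable (dist x0 ` E)" using assms(3) by simp
  then have "\<exists>\<rho>. \<rho> \<in> {0<..<s} - dist x0 ` E"
    using uncountable_open_interval[of 0 s] s(1) by (metis countable_subset Diff_eq_empty_iff equals0I)
  then obtain \<rho> where \<rho>: "0 < \<rho>" "\<rho> < s" "\<And>e. e \<in> E \<Longrightarrow> dist x0 e \<noteq> \<rho>" by auto
  have bump: "\<exists>t>0. \<exists>h\<in>R X. h x0 = 1 \<and> (\<forall>z\<in>X \<inter> ball c t. h z = 0)" if c: "c \<in> X \<inter> sphere x0 \<rho>" for c
  proof -
    have "c \<in> X - E" using c \<rho>(3) by auto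
    then obtain \<alpha> where \<alpha>: "\<alpha> \<in> I" "c \<in> top_of_set X interior_of (X \<inter> Y \<alpha>)" using assms(6) by blast
    then obtain T where "openin (top_of_set X) T" "c \<in> T" "T \<subseteq> X \<inter> Y \<alpha>"
      unfolding interior_of_def by blast
    then obtain U where U: "open U" "c \<in> U" "X \<inter> U \<subseteq> Y \<alpha>" unfolding openin_open by blast
    then obtain u where u: "u > 0" "cball c u \<subseteq> U" using open_contains_cball by blast
    \<comment> \<open>\<open>t < \<rho>\<close> keeps \<open>x0\<close> outside the disc around
      \<open>c\<close>, so the bump does not change the value at \<open>x0\<close>.\<close>
    define t where "t = min u (\<rho> / 2)"
    have t: "0 < t" "t < \<rho>" using u \<rho> by (auto simp: t_def min_def)
    have Yc: "compact (Y \<alpha>)" using assms(4)[OF \<alpha>(1)] by (simp add: compact_plane_set_def)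
    \<comment> \<open>Three radii: \<open>b\<close> is 1 up to \<open>t / 3\<close> and 0 from
      \<open>t / 2\<close> on, leaving the annulus up to \<open>t\<close> for
      \<open>R_cutoff\<close>.\<close>
    have "cball c (t / 3) \<inter> {z. t / 2 \<le> dist c z} \<inter> Y \<alpha> = {}" using t by auto
    moreover have "closed {z. t / 2 \<le> dist c z}"
      by (intro closed_Collect_le continuous_intros)
    ultimately obtain b where b: "b \<in> R (Y \<alpha>)" "\<forall>z\<in>Y \<alpha> \<inter> cball c (t / 3). b z = 1"
      "\<forall>z\<in>Y \<alpha> \<inter> {z. t / 2 \<le> dist c z}. b z = 0"
      using regular_on_R_normal[OF Yc assms(5)[OF \<alpha>(1)] closed_cball] by metis
    have XY: "X \<inter> cball c t \<subseteq> Y \<alpha>" using U(3) u(2) by (auto simp: t_def)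
    have "(\<lambda>z. if dist c z \<le> t then b z else 0) \<in> R X"
      by (rule R_cutoff[OF X XY b(1), of "t / 2"]) (use t b(3) XY in auto)
    then have "(\<lambda>z. 1 - (if dist c z \<le> t then b z else 0)) \<in> R X"
      by (intro R_diff[OF X] R_const)
    moreover have "\<not> dist c x0 \<le> t" using c t by (simp add: dist_commute)
    moreover have "1 - (if dist c z \<le> t then b z else 0) = 0" if "z \<in> X \<inter> ball c (t / 3)" for z
    proof -
      have "z \<in> Y \<alpha>" using that XY t by auto
      then show ?thesis using that b(2) t by auto
    qed
    ultimately show ?thesis using t
      by (intro exI[of _ "t / 3"] conjI bexI[of _ "\<lambda>z. 1 - (if dist c z \<le> t then b z else 0)"]) auto
  qed
  then obtain t h where th: "\<And>c. c \<in> X \<inter> sphere x0 \<rho> \<Longrightarrow> t c > 0"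
    "\<And>c. c \<in> X \<inter> sphere x0 \<rho> \<Longrightarrow> h c \<in> R X"
    "\<And>c. c \<in> X \<inter> sphere x0 \<rho> \<Longrightarrow> h c x0 = 1"
    "\<And>c z. c \<in> X \<inter> sphere x0 \<rho> \<Longrightarrow> z \<in> X \<inter> ball c (t c) \<Longrightarrow> h c z = 0"
    by metis
  have cpt: "compact (X \<inter> sphere x0 \<rho>)" using X by (intro compact_Int_closed) auto
  have cov: "X \<inter> sphere x0 \<rho> \<subseteq> (\<Union>c\<in>X \<inter> sphere x0 \<rho>. ball c (t c))" using th(1) by force
  obtain C where C: "C \<subseteq> X \<inter> sphere x0 \<rho>" "finite C"
    "X \<inter> sphere x0 \<rho> \<subseteq> (\<Union>c\<in>C. ball c (t c))"
    by (rule compactE_image[OF cpt _ cov]) (rule open_ball, rule that)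
  define H where "H = (\<lambda>z. \<Prod>c\<in>C. h c z)"
  have H: "H \<in> R X" unfolding H_def by (intro R_prod X C(2) th(2)) (use C(1) in blast)
  have H1: "H x0 = 1" unfolding H_def using C th(3) by (intro prod.neutral) blast
  define V where "V = (\<Union>c\<in>C. ball c (t c))"
  have H0: "H z = 0" if z: "z \<in> X \<inter> V" for z
  proof -
    obtain c where "c \<in> C" "z \<in> ball c (t c)" using z by (auto simp: V_def)
    then have "h c z = 0" using th(4)[of c z] C z by blast
    then show ?thesis unfolding H_def using C(2) \<open>c \<in> C\<close> by (intro prod_zero) auto
  qed
  \<comment> \<open>Compactness widens the circle to an annulus of positive width on which
    \<open>H\<close> still vanishes.\<close>
  have "compact (X - V)" unfolding V_def by (intro compact_diff X) auto
  moreover have "(X - V) \<inter> sphere x0 \<rho> = {}" using C(3) unfolding V_def by blast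
  ultimately obtain d where d: "d > 0" "\<And>z y. z \<in> X - V \<Longrightarrow> y \<in> sphere x0 \<rho> \<Longrightarrow> d \<le> dist z y"
    using separate_compact_closed[of "X - V" "sphere x0 \<rho>"] by (metis closed_sphere)
  have ann: "z \<in> V" if z: "z \<in> X" "\<bar>dist x0 z - \<rho>\<bar> < d" "z \<noteq> x0" for z
  proof (rule ccontr)
    assume "z \<notin> V"
    \<comment> \<open>The radial projection of \<open>z\<close> to the circle; its distance from
      \<open>z\<close> is \<open>\<bar>dist x0 z - \<rho>\<bar>\<close>.\<close>
    define y where "y = x0 + of_real (\<rho> / dist x0 z) * (z - x0)"
    have dz: "dist x0 z > 0" using z by simp
    have "dist x0 y = norm (y - x0)" by (simp add: dist_norm norm_minus_commute)
    also have "y - x0 = of_real (\<rho> / dist x0 z) * (z - x0)" by (simp add: y_def)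
    also have "norm \<dots> = \<rho>" using dz \<rho> by (simp add: norm_mult norm_divide dist_norm norm_minus_commute)
    finally have "y \<in> sphere x0 \<rho>" by simp
    then have "d \<le> dist z y" using d(2)[of z y] z \<open>z \<notin> V\<close> by simp
    moreover have "z - y = of_real (1 - \<rho> / dist x0 z) * (z - x0)"
      by (simp add: y_def algebra_simps)
    then have "dist z y = \<bar>1 - \<rho> / dist x0 z\<bar> * dist x0 z"
      unfolding dist_norm by (metis norm_minus_commute norm_mult norm_of_real)
    then have "dist z y = \<bar>(1 - \<rho> / dist x0 z) * dist x0 z\<bar>" by (simp add: abs_mult)
    moreover have "(1 - \<rho> / dist x0 z) * dist x0 z = dist x0 z - \<rho>"
      using dz by (simp add: algebra_simps)
    ultimately show False using z by simp
  qed
  \<comment> \<open>\<open>e < d\<close> puts the annulus into \<open>V\<close>,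
    \<open>e < \<rho>\<close> keeps its inner radius positive, and \<open>e < s - \<rho>\<close>
    leaves \<open>A\<close> outside.\<close>
  define e where "e = min (d / 2) (min (\<rho> / 2) ((s - \<rho>) / 2))"
  have e: "e > 0" "e < d" "e < \<rho>" "e < s - \<rho>" using d \<rho> by (auto simp: e_def min_def)
  define f where "f = (\<lambda>z. if dist x0 z \<le> \<rho> + e then H z else 0)"
  have "f \<in> R X" unfolding f_def
  \<comment> \<open>Here \<open>X\<close> also takes the place of \<open>Y\<close>: the cutoff is
    applied to a function already in \<open>R X\<close>.\<close>
  proof (rule R_cutoff[OF X _ H])
    fix z assume z: "z \<in> X" "\<rho> - e \<le> dist x0 z" "dist x0 z \<le> \<rho> + e"
    then have "z \<in> V" using e by (intro ann) auto
    then show "H z = 0" using H0 z by blast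
  qed (use e in auto)
  moreover have "f x0 = 1" using H1 \<rho> e by (simp add: f_def)
  moreover have "f y = 0" if "y \<in> A" for y
  proof -
    have "s \<le> dist x0 y" using s(2) that by force
    then show ?thesis using e by (simp add: f_def)
  qed
  ultimately show "\<exists>f\<in>R X. f x0 = 1 \<and> (\<forall>y\<in>A. f y = 0)" by blast
qed

end
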